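(* Let $K$ be a compact metric space and let $X$ be a standard continuous (atomless) measure space, e.g. $X=[0,1]$ with Lebesgue measure $\mu$. Let $k$ be a positive integer and let $f:X^k\to K$ be measurable (with respect to the Borel $\sigma$-algebra on $K$). Let $\mathcal N_k$ be the set of all ordered $k$-tuples $I=(i_1,\dots,i_k)$ of mutually distinct positive integers. For $I\in\mathcal N_k$ and points $y_1,y_2,\dots\in X$ put $f_I(y_1,y_2,\dots):=f(y_{i_1},\dots,y_{i_k})$, and let $\tilde f:X^{\mathbb N}\to K^{\mathcal N_k}$ be the map sending $(y_1,y_2,\dots)$ to the function $I\mapsto f_I(y_1,y_2,\dots)$ on $\mathcal N_k$; here $K^{\mathcal N_k}$ carries the product (Tychonoff) topology. For any other function $g:X^k\to K$ define $\tilde g$ in the same way. Let $M\subset K^{\mathcal N_k}$ be a closed set, and assume that $\tilde f(y_1,y_2,\dots)\in M$ for almost all $(y_1,y_2,\dots)\in X^{\mathbb N}$ (with respect to the product measure). 1. Then there exists a measurable function $g:X^k\to K$, equal to $f$ almost everywhere on $X^k$, such that $\tilde g(y_1,y_2,\dots)\in M$ for all sequences $y_1,y_2,\dots$ of mutually distinct points of $X$. 2. Assume additionally that $f$ is almost symmetric, i.e. for every permutation $\pi$ of $\{1,\dots,k\}$ one has $f(x_1,\dots,x_k)=f(x_{\pi(1)},\dots,x_{\pi(k)})$ for almost all $(x_1,\dots,x_k)\in X^k$. Then there exists a measurable symmetric function $g:X^k\to K$, equal to $f$ almost everywhere, such that $\tilde g(y_1,y_2,\dots)\in M$ for all (not necessarily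 distinct) $y_1,y_2,\dots\in X$.
   Context: A function $g$ is called equivalent to $f$ if $g=f$ almost everywhere on $X^k$. A function $g$ on $X^k$ is symmetric if $g(x_1,\dots,x_k)=g(x_{\pi(1)},\dots,x_{\pi(k)})$ for all $x_1,\dots,x_k\in X$ and all permutations $\pi$ of $\{1,\dots,k\}$. *)

theory Defs
  imports "HOL-Probability.Probability" "HOL-Combinatorics.Permutations"
begin

(* Standard in the measure-theoretic sense: up to completion, the sigma-algebra is the Borel
   sigma-algebra of a Polish topology on the space.  Both the Borel and the Lebesgue sigma-algebra
   on [0,1] are allowed, since measurable sets need only lie between two Borel sets whose
   difference is null. *)
definition standard_measure_space :: "'a measure \<Rightarrow> bool" where
  "standard_measure_space X \<longleftrightarrow>
    (\<exists>T. topspace T = space X \<and> completely_metrizable_space T \<and> second_countable T \<and>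
         sigma_sets (space X) {U. openin T U} \<subseteq> sets X \<and>
         (\<forall>A\<in>sets X. \<exists>B\<in>sigma_sets (space X) {U. openin T U}.
                      \<exists>C\<in>sigma_sets (space X) {U. openin T U}.
                        B \<subseteq> A \<and> A \<subseteq> C \<and> C - B \<in> null_sets X))"

definition atomless :: "'a measure \<Rightarrow> bool" where
  "atomless X \<longleftrightarrow>
    (\<forall>A\<in>sets X. emeasure X A > 0 \<longrightarrow>
      (\<exists>B\<in>sets X. B \<subseteq> A \<and> 0 < emeasure X B \<and> emeasure X B < emeasure X A))"

(* k-tuples are extensional functions on {..<k}, and sequences are functions on nat: all
   indices start at 0 instead of 1. *)
abbreviation tuple_space :: "nat \<Rightarrow> 'a measure \<Rightarrow> (nat \<Rightarrow> 'a) measure" where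
  "tuple_space k X \<equiv> (\<Pi>\<^sub>M i\<in>{..<k}. X)"

abbreviation seq_space :: "'a measure \<Rightarrow> (nat \<Rightarrow> 'a) measure" where
  "seq_space X \<equiv> (\<Pi>\<^sub>M i\<in>UNIV. X)"

definition distinct_tuples :: "nat \<Rightarrow> (nat \<Rightarrow> nat) set" where
  "distinct_tuples k = {I \<in> {..<k} \<rightarrow>\<^sub>E UNIV. inj_on I {..<k}}"

definition tilde :: "nat \<Rightarrow> ((nat \<Rightarrow> 'a) \<Rightarrow> 'b) \<Rightarrow> (nat \<Rightarrow> 'a) \<Rightarrow> ((nat \<Rightarrow> nat) \<Rightarrow> 'b)" where
  "tilde k f y = (\<lambda>I\<in>distinct_tuples k. f (\<lambda>j\<in>{..<k}. y (I j)))"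

(* Lebesgue measurability: X^k carries the completed product sigma-algebra. *)
definition tuple_measurable ::
    "nat \<Rightarrow> 'a measure \<Rightarrow> ((nat \<Rightarrow> 'a) \<Rightarrow> 'b::topological_space) \<Rightarrow> bool" where
  "tuple_measurable k X f \<longleftrightarrow> f \<in> borel_measurable (completion (tuple_space k X))"

definition symmetric_fun :: "nat \<Rightarrow> 'a measure \<Rightarrow> ((nat \<Rightarrow> 'a) \<Rightarrow> 'b) \<Rightarrow> bool" where
  "symmetric_fun k X g \<longleftrightarrow>
    (\<forall>\<pi>. \<pi> permutes {..<k} \<longrightarrow>
      (\<forall>x\<in>space (tuple_space k X). g x = g (\<lambda>j\<in>{..<k}. x (\<pi> j))))"

definition almost_symmetric_fun :: "nat \<Rightarrow> 'a measure \<Rightarrow> ((nat \<Rightarrow> 'a) \<Rightarrow> 'b) \<Rightarrow> bool" where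
  "almost_symmetric_fun k X f \<longleftrightarrow>
    (\<forall>\<pi>. \<pi> permutes {..<k} \<longrightarrow>
      (AE x in tuple_space k X. f x = f (\<lambda>j\<in>{..<k}. x (\<pi> j))))"

end

theory Submission
  imports Defs "HOL-Library.Ramsey"
begin

text \<open>
  Cut \<^term>\<open>X\<close> at level \<^term>\<open>n\<close> into finitely many cells so fine that \<^term>\<open>f\<close> is, up to an
  error \<open>2\<^sup>-\<^sup>n\<close> outside a set of measure \<open>2\<^sup>-\<^sup>n\<close>, determined by the cells of the
  coordinates, and draw independent random points, one from each cell of each level. Let
  \<open>\<phi> n x\<close> be the point drawn from the level \<open>n\<close> cell of \<open>x\<close>. For random \<open>x\<close>, replacing
  coordinates \<open>x i\<close> by \<open>\<phi> (N i) (x i)\<close> with pairwise distinct levels \<open>N i\<close> does not change the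
  law of the tuple; hence, by Borel--Cantelli, almost every tuple \<open>x\<close> is good: letting one further
  level tend to infinity undoes the replacement of that coordinate in the limit. On the other hand
  the drawn points form almost surely a countable set of which every finite list of distinct samples
  extends to a sequence that satisfies the constraint.

  Given finitely many points, choose distinct levels \<open>n p\<close> for them, one after the other, so that
  \<open>x \<mapsto> f (\<phi> (n (x 1)) (x 1), \<dots>, \<phi> (n (x k)) (x k))\<close> nearly agrees with \<open>f\<close> on good tuples. It
  satisfies the constraint on sequences of distinct points, and a cluster point of these functions in
  the Tychonoff topology is the required version of \<open>f\<close>. For symmetric \<open>f\<close> and repeated points,
  one uses several levels for each point, and Ramsey's theorem makes the value nearly independent of
  which of these levels are chosen.
\<close>

subsection \<open>Approximation by cells\<close>

definition same_cells :: "(nat \<Rightarrow> 'a set) \<Rightarrow> nat \<Rightarrow> nat \<Rightarrow> (nat \<Rightarrow> 'a) \<Rightarrow> (nat \<Rightarrow> 'a) \<Rightarrow> bool" where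
  "same_cells U k n x y \<longleftrightarrow> (\<forall>i<k. \<forall>j<n. x i \<in> U j \<longleftrightarrow> y i \<in> U j)"

text \<open>The saturated set \<open>D\<close> is a finite union of products of cells of the
  partition generated by \<open>U 0\<close>, ..., \<open>U (n - 1)\<close>. Saturation under
  \<open>same_cells\<close> expresses this without naming the cells.\<close>

definition cell_approximable :: "'a measure \<Rightarrow> (nat \<Rightarrow> 'a set) \<Rightarrow> nat \<Rightarrow> (nat \<Rightarrow> 'a) set \<Rightarrow> bool" where
  "cell_approximable X U k A \<longleftrightarrow> A \<in> sets (tuple_space k X) \<and>
    (\<forall>\<epsilon>>0. \<exists>n. \<exists>D\<in>sets (tuple_space k X).
      (\<forall>x\<in>D. \<forall>y\<in>space (tuple_space k X). same_cells U k n x y \<longrightarrow> y \<in> D) \<and>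
      measure (tuple_space k X) (sym_diff A D) < \<epsilon>)"

lemma cell_approximableD:
  assumes "cell_approximable X U k A" and "\<epsilon> > 0"
  obtains n D where "D \<in> sets (tuple_space k X)"
    "\<And>x y. x \<in> D \<Longrightarrow> y \<in> space (tuple_space k X) \<Longrightarrow> same_cells U k n x y \<Longrightarrow> y \<in> D"
    "measure (tuple_space k X) (sym_diff A D) < \<epsilon>"
proof -
  from assms have "\<exists>n. \<exists>D\<in>sets (tuple_space k X).
      (\<forall>x\<in>D. \<forall>y\<in>space (tuple_space k X). same_cells U k n x y \<longrightarrow> y \<in> D) \<and>
      measure (tuple_space k X) (sym_diff A D) < \<epsilon>"
    by (simp only: cell_approximable_def)
  then show thesis
    using that by metis
qed

lemma same_cells_mono: "same_cells U k n x y \<Longrightarrow> m \<le> n \<Longrightarrow> same_cells U k m x y"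
  by (auto simp: same_cells_def)

lemma same_cells_sym: "same_cells U k n x y \<Longrightarrow> same_cells U k n y x"
  by (auto simp: same_cells_def)

context
  fixes X :: "'a measure" and U :: "nat \<Rightarrow> 'a set" and k :: nat
  assumes X: "prob_space X"
begin

interpretation P: prob_space "tuple_space k X"
  using X by (intro prob_space_PiM) auto

lemma cell_approximable_Compl:
  assumes A: "cell_approximable X U k A"
  shows "cell_approximable X U k (space (tuple_space k X) - A)"
  unfolding cell_approximable_def
proof (intro conjI allI impI)
  let ?S = "space (tuple_space k X)"
  show "?S - A \<in> sets (tuple_space k X)"
    using A by (auto simp: cell_approximable_def)
  fix \<epsilon> :: real assume "\<epsilon> > 0"
  then obtain n D where D: "D \<in> sets (tuple_space k X)"
    "\<And>x y. x \<in> D \<Longrightarrow> y \<in> ?S \<Longrightarrow> same_cells U k n x y \<Longrightarrow> y \<in> D"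
    "measure (tuple_space k X) (sym_diff A D) < \<epsilon>"
    using cell_approximableD[OF A \<open>\<epsilon> > 0\<close>] by metis
  have "sym_diff (?S - A) (?S - D) = sym_diff A D"
    using sets.sets_into_space[OF D(1)] sets.sets_into_space[of A "tuple_space k X"] A
    unfolding cell_approximable_def by blast
  then show "\<exists>n. \<exists>D\<in>sets (tuple_space k X).
      (\<forall>x\<in>D. \<forall>y\<in>?S. same_cells U k n x y \<longrightarrow> y \<in> D) \<and>
      measure (tuple_space k X) (sym_diff (?S - A) D) < \<epsilon>"
    using D by (intro exI[of _ n] bexI[of _ "?S - D"] conjI ballI impI) (auto dest: same_cells_sym)
qed

text \<open>A finite partial union already carries all but \<open>\<epsilon>/2\<close> of the
  measure; its members are approximated separately with total error below
  \<open>\<epsilon>/2\<close>, and the finest of the finitely many partitions serves them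
  all.\<close>

lemma cell_approximable_UN:
  fixes A :: "nat \<Rightarrow> _"
  assumes A: "\<And>i. cell_approximable X U k (A i)"
  shows "cell_approximable X U k (\<Union>i. A i)"
  unfolding cell_approximable_def
proof (intro conjI allI impI)
  let ?M = "tuple_space k X"
  have As[measurable]: "A i \<in> sets ?M" for i
    using A[of i] by (auto simp: cell_approximable_def)
  show "(\<Union>i. A i) \<in> sets ?M" by measurable
  fix \<epsilon> :: real assume "\<epsilon> > 0"
  have "(\<lambda>m. measure ?M (\<Union>i<m. A i)) \<longlonglongrightarrow> measure ?M (\<Union>m. \<Union>i<m. A i)"
    by (intro P.finite_Lim_measure_incseq) (auto simp: incseq_def intro: order_less_le_trans)
  moreover have "(\<Union>m. \<Union>i<m. A i) = (\<Union>i. A i)" by auto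
  ultimately have "(\<lambda>m. measure ?M (\<Union>i<m. A i)) \<longlonglongrightarrow> measure ?M (\<Union>i. A i)" by simp
  then have "eventually (\<lambda>m. measure ?M (\<Union>i<m. A i) > measure ?M (\<Union>i. A i) - \<epsilon>/2) sequentially"
    using \<open>\<epsilon> > 0\<close> by (intro order_tendstoD(1)) auto
  then obtain m where m: "measure ?M (\<Union>i<m. A i) > measure ?M (\<Union>i. A i) - \<epsilon>/2"
    by (auto simp: eventually_sequentially)
  \<comment> \<open>\<open>Suc m\<close> in place of \<open>m\<close> keeps the tolerance meaningful
    for \<open>m = 0\<close> and makes the sum of the \<open>m\<close> tolerances strictly smaller
    than \<open>\<epsilon>/2\<close>.\<close>
  have "\<exists>n D. D \<in> sets ?M \<and>
      (\<forall>x\<in>D. \<forall>y\<in>space ?M. same_cells U k n x y \<longrightarrow> y \<in> D) \<and>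
      measure ?M (sym_diff (A i) D) < \<epsilon> / (2 * Suc m)" for i
  proof -
    have "\<epsilon> / (2 * Suc m) > 0" using \<open>\<epsilon> > 0\<close> by simp
    from cell_approximableD[OF A[of i] this] show ?thesis by metis
  qed
  then obtain n D where D[measurable]: "\<And>i. D i \<in> sets ?M"
    and D_cells: "\<And>i x y. x \<in> D i \<Longrightarrow> y \<in> space ?M \<Longrightarrow> same_cells U k (n i) x y \<Longrightarrow> y \<in> D i"
    and D_le: "\<And>i. measure ?M (sym_diff (A i) (D i)) < \<epsilon> / (2 * Suc m)"
    by metis
  define N where "N = Max (n ` {..m})"
  have N: "n i \<le> N" if "i < m" for i
    using that unfolding N_def by (intro Max_ge) auto
  have "measure ?M (sym_diff (\<Union>i. A i) (\<Union>i<m. D i))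
      \<le> measure ?M (((\<Union>i. A i) - (\<Union>i<m. A i)) \<union> (\<Union>i<m. sym_diff (A i) (D i)))"
    by (intro P.finite_measure_mono) auto
  also have "\<dots> \<le> measure ?M ((\<Union>i. A i) - (\<Union>i<m. A i)) + measure ?M (\<Union>i<m. sym_diff (A i) (D i))"
    by (intro measure_Un_le) auto
  also have "measure ?M ((\<Union>i. A i) - (\<Union>i<m. A i)) = measure ?M (\<Union>i. A i) - measure ?M (\<Union>i<m. A i)"
    by (intro P.finite_measure_Diff) auto
  also have "measure ?M (\<Union>i<m. sym_diff (A i) (D i)) \<le> (\<Sum>i<m. measure ?M (sym_diff (A i) (D i)))"
    by (intro measure_UNION_le) auto
  also have "\<dots> \<le> (\<Sum>i<m. \<epsilon> / (2 * Suc m))"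
    using D_le by (intro sum_mono less_imp_le)
  also have "\<dots> < \<epsilon> / 2"
    using \<open>\<epsilon> > 0\<close> by (simp add: field_simps)
  finally have "measure ?M (sym_diff (\<Union>i. A i) (\<Union>i<m. D i)) < \<epsilon>"
    using m by simp
  moreover have "y \<in> (\<Union>i<m. D i)"
    if x: "x \<in> (\<Union>i<m. D i)" and y: "y \<in> space ?M" and xy: "same_cells U k N x y" for x y
  proof -
    obtain i where i: "i < m" "x \<in> D i" using x by auto
    with D_cells[OF i(2) y same_cells_mono[OF xy N[OF i(1)]]] show ?thesis by blast
  qed
  moreover have "(\<Union>i<m. D i) \<in> sets ?M" by measurable
  ultimately show "\<exists>n. \<exists>D\<in>sets ?M. (\<forall>x\<in>D. \<forall>y\<in>space ?M. same_cells U k n x y \<longrightarrow> y \<in> D) \<and>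
      measure ?M (sym_diff (\<Union>i. A i) D) < \<epsilon>"
    by (intro exI[of _ N] bexI[of _ "\<Union>i<m. D i"] conjI ballI impI)
qed

text \<open>Triangle inequality for symmetric differences. This passes from generated sets to
  measurable sets that agree with them only up to a null set.\<close>

lemma cell_approximable_null:
  assumes A: "cell_approximable X U k A" and B: "B \<in> sets (tuple_space k X)"
    and AB: "measure (tuple_space k X) (sym_diff A B) = 0"
  shows "cell_approximable X U k B"
  unfolding cell_approximable_def
proof (intro conjI allI impI)
  let ?M = "tuple_space k X"
  have [measurable]: "A \<in> sets ?M" "B \<in> sets ?M"
    using A B by (auto simp: cell_approximable_def)
  fix \<epsilon> :: real assume "\<epsilon> > 0"
  then obtain n D where D[measurable]: "D \<in> sets ?M"
    and D': "\<And>x y. x \<in> D \<Longrightarrow> y \<in> space ?M \<Longrightarrow> same_cells U k n x y \<Longrightarrow> y \<in> D"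
    "measure (tuple_space k X) (sym_diff A D) < \<epsilon>"
    using cell_approximableD[OF A \<open>\<epsilon> > 0\<close>] by metis
  have "measure ?M (sym_diff B D) \<le> measure ?M (sym_diff A B \<union> sym_diff A D)"
    by (intro P.finite_measure_mono) auto
  also have "\<dots> \<le> measure ?M (sym_diff A B) + measure ?M (sym_diff A D)"
    by (intro measure_Un_le) auto
  finally show "\<exists>n. \<exists>D\<in>sets ?M. (\<forall>x\<in>D. \<forall>y\<in>space ?M. same_cells U k n x y \<longrightarrow> y \<in> D) \<and>
      measure ?M (sym_diff B D) < \<epsilon>"
    using D D' AB by (intro exI[of _ n] bexI[of _ D] conjI ballI impI) auto
qed (rule B)

text \<open>Approximable sets form a sigma-algebra. It contains the one-coordinate cylinders over
  each \<open>U j\<close>, hence those over the generated sets, hence, by sandwiching, those over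
  all measurable sets, and these cylinders generate the product sigma-algebra.\<close>

lemma cell_approximable_sets:
  assumes U: "\<And>n. U n \<in> sets X"
    and gen: "\<And>A. A \<in> sets X \<Longrightarrow> \<exists>B\<in>sigma_sets (space X) (range U).
      \<exists>C\<in>sigma_sets (space X) (range U). B \<subseteq> A \<and> A \<subseteq> C \<and> C - B \<in> null_sets X"
    and A: "A \<in> sets (tuple_space k X)"
  shows "cell_approximable X U k A"
proof -
  let ?M = "tuple_space k X"
  have empty: "cell_approximable X U k {}"
    unfolding cell_approximable_def
    by (intro conjI allI impI exI[of _ 0] bexI[of _ "{}"]) auto
  have base: "cell_approximable X U k {x \<in> space ?M. x i \<in> U j}" if "i < k" for i j
    unfolding cell_approximable_def
  proof (intro conjI allI impI)
    show 1: "{x \<in> space ?M. x i \<in> U j} \<in> sets ?M"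
      using U \<open>i < k\<close> by (intro sets_Collect_single') auto
    show "\<exists>n. \<exists>D\<in>sets ?M. (\<forall>x\<in>D. \<forall>y\<in>space ?M. same_cells U k n x y \<longrightarrow> y \<in> D) \<and>
      measure ?M (sym_diff {x \<in> space ?M. x i \<in> U j} D) < \<epsilon>" if "\<epsilon> > 0" for \<epsilon> :: real
      using 1 that \<open>i < k\<close>
      by (intro exI[of _ "Suc j"] bexI[of _ "{x \<in> space ?M. x i \<in> U j}"]) (auto simp: same_cells_def)
  qed
  have borel: "cell_approximable X U k {x \<in> space ?M. x i \<in> B}"
    if "i < k" "B \<in> sigma_sets (space X) (range U)" for i B
    using that(2)
  proof induction
    case (Basic a) then show ?case using base[OF \<open>i < k\<close>] by auto
  next
    case Empty then show ?case using empty by simp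
  next
    case (Compl a)
    have "{x \<in> space ?M. x i \<in> space X - a} = space ?M - {x \<in> space ?M. x i \<in> a}"
      using \<open>i < k\<close> by (auto simp: space_PiM)
    then show ?case using cell_approximable_Compl[OF Compl.IH] by simp
  next
    case (Union a)
    have "{x \<in> space ?M. x i \<in> (\<Union>j. a j)} = (\<Union>j. {x \<in> space ?M. x i \<in> a j})"
      by auto
    then show ?case using cell_approximable_UN[OF Union.IH] by simp
  qed
  have side: "cell_approximable X U k {x \<in> space ?M. x i \<in> B}"
    if i: "i < k" and B: "B \<in> sets X" for i B
  proof -
    obtain C D where C: "C \<in> sigma_sets (space X) (range U)" and CD: "C \<subseteq> B" "B \<subseteq> D" "D - C \<in> null_sets X"
      using gen[OF B] by blast
    have "C \<in> sets X"
      using C U by (meson image_subsetI sets.sigma_sets_subset subsetD)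
    then have [measurable]: "{x \<in> space ?M. x i \<in> C} \<in> sets ?M" "{x \<in> space ?M. x i \<in> B} \<in> sets ?M"
       using \<open>i < k\<close> B by (auto intro!: sets_Collect_single')
    \<comment> \<open>The cylinders over \<open>B\<close> and over its inner approximation
      \<open>C\<close> differ only where coordinate \<open>i\<close> falls into the null set
      \<open>D - C\<close>; as coordinate \<open>i\<close> has law \<open>X\<close>, this has
      probability zero.\<close>
    have "AE x in X. x \<notin> D - C"
      using CD(3) AE_not_in by blast
    then have "AE x in ?M. x i \<notin> D - C"
      using X i by (intro AE_PiM_component) auto
    then have "AE x in ?M. x \<notin> sym_diff {x \<in> space ?M. x i \<in> C} {x \<in> space ?M. x i \<in> B}"
      using CD by (auto elim!: eventually_mono)
    then have "measure ?M (sym_diff {x \<in> space ?M. x i \<in> C} {x \<in> space ?M. x i \<in> B}) = 0"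
      by (subst P.prob_eq_0) auto
    then show ?thesis
      by (intro cell_approximable_null[OF borel[OF i C]]) auto
  qed
  have "A \<in> sigma_sets (space ?M) {{f \<in> space ?M. f i \<in> B} |i B. i \<in> {..<k} \<and> B \<in> sets X}"
    using A unfolding sets_PiM_single by (simp add: space_PiM)
  then show ?thesis
    by induction (auto intro: side empty cell_approximable_Compl cell_approximable_UN)
qed

text \<open>By compactness finitely many balls of radius \<open>\<epsilon>/2\<close> cover the
  range. Off a small set, membership of \<open>f x\<close> in each ball is decided by the cells of
  \<open>x\<close>, so values at tuples with the same cells lie in a common ball.\<close>

lemma cells_nearly_determine_function:
  fixes f :: "(nat \<Rightarrow> 'a) \<Rightarrow> 'b::metric_space" and \<epsilon> :: real
  assumes U: "\<And>n. U n \<in> sets X"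
    and gen: "\<And>A. A \<in> sets X \<Longrightarrow> \<exists>B\<in>sigma_sets (space X) (range U).
      \<exists>C\<in>sigma_sets (space X) (range U). B \<subseteq> A \<and> A \<subseteq> C \<and> C - B \<in> null_sets X"
    and K: "compact (UNIV :: 'b set)"
    and f: "tuple_measurable k X f" and "\<epsilon> > 0"
  shows "\<exists>n. \<exists>B\<in>sets (tuple_space k X). measure (tuple_space k X) B \<le> \<epsilon> \<and>
    (\<forall>x\<in>space (tuple_space k X) - B. \<forall>y\<in>space (tuple_space k X) - B.
      same_cells U k n x y \<longrightarrow> dist (f x) (f y) < \<epsilon>)"
proof -
  let ?M = "tuple_space k X"
  obtain T where T: "finite T" "(UNIV :: 'b set) \<subseteq> (\<Union>t\<in>T. ball t (\<epsilon>/2))"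
    using K half_gt_zero[OF \<open>\<epsilon> > 0\<close>] unfolding compact_eq_totally_bounded by blast
  have fs: "f -` ball t (\<epsilon>/2) \<inter> space ?M \<in> sets (completion ?M)" for t
    using measurable_sets[OF f[unfolded tuple_measurable_def], of "ball t (\<epsilon>/2)"] by simp
  \<comment> \<open>Each ball gets the share \<open>\<epsilon> / c\<close> of the exceptional
    measure; \<open>Suc\<close> makes \<open>c\<close> positive without a case distinction on
    \<open>T\<close>.\<close>
  define c where "c = real (Suc (card T))"
  have "c > 0" by (simp add: c_def)
  have "\<exists>n B D. B \<in> sets ?M \<and> D \<in> sets ?M \<and> measure ?M B \<le> \<epsilon> / c \<and>
      (\<forall>x\<in>D. \<forall>y\<in>space ?M. same_cells U k n x y \<longrightarrow> y \<in> D) \<and>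
      (\<forall>x\<in>space ?M - B. x \<in> D \<longleftrightarrow> f x \<in> ball t (\<epsilon>/2))" for t
  proof -
    \<comment> \<open>Preimages under \<open>f\<close> are measurable only for the completion. The
      null set \<open>N'\<close> covering the non-measurable remainder is added to the exceptional
      set.\<close>
    obtain S N N' where S: "f -` ball t (\<epsilon>/2) \<inter> space ?M = S \<union> N" "N \<subseteq> N'" "N' \<in> null_sets ?M" "S \<in> sets ?M"
      using sets_completionE[OF fs] by metis
    obtain n D where D[measurable]: "D \<in> sets ?M"
      and D': "\<And>x y. x \<in> D \<Longrightarrow> y \<in> space ?M \<Longrightarrow> same_cells U k n x y \<Longrightarrow> y \<in> D"
        "measure ?M (sym_diff S D) < \<epsilon> / c"
      using cell_approximableD[OF cell_approximable_sets[OF U gen S(4)] divide_pos_pos[OF \<open>\<epsilon> > 0\<close> \<open>c > 0\<close>]]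
      by metis
    have [measurable]: "N' \<in> sets ?M" "S \<in> sets ?M" using S by auto
    have "measure ?M (sym_diff S D \<union> N') \<le> measure ?M (sym_diff S D) + measure ?M N'"
      by (intro measure_Un_le) auto
    moreover have "measure ?M N' = 0"
      using S(3) by (simp add: measure_eq_0_null_sets)
    moreover have "x \<in> D \<longleftrightarrow> f x \<in> ball t (\<epsilon>/2)" if "x \<in> space ?M - (sym_diff S D \<union> N')" for x
      using that S(1,2) by blast
    moreover have "sym_diff S D \<union> N' \<in> sets ?M" by measurable
    ultimately show ?thesis
      using D D'
      by (intro exI[of _ n] exI[of _ "sym_diff S D \<union> N'"] exI[of _ D] conjI ballI impI) (simp, simp, linarith, blast+)
  qed
  then obtain n B D where B[measurable]: "\<And>t. B t \<in> sets ?M" and D: "\<And>t. D t \<in> sets ?M"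
    and B_le: "\<And>t. measure ?M (B t) \<le> \<epsilon> / c"
    and cells: "\<And>t x y. x \<in> D t \<Longrightarrow> y \<in> space ?M \<Longrightarrow> same_cells U k (n t) x y \<Longrightarrow> y \<in> D t"
    and f_D: "\<And>t x. x \<in> space ?M - B t \<Longrightarrow> x \<in> D t \<longleftrightarrow> f x \<in> ball t (\<epsilon>/2)"
    by metis
  define N where "N = Max (n ` T)"
  have N: "n t \<le> N" if "t \<in> T" for t
    using that T(1) unfolding N_def by (intro Max_ge) auto
  define BB where "BB = (\<Union>t\<in>T. B t)"
  have "measure ?M BB \<le> (\<Sum>t\<in>T. measure ?M (B t))"
    unfolding BB_def using T(1) by (intro measure_UNION_le) auto
  also have "\<dots> \<le> (\<Sum>t\<in>T. \<epsilon> / c)"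
    using B_le by (intro sum_mono)
  also have "\<dots> \<le> \<epsilon>"
    using \<open>\<epsilon> > 0\<close> by (simp add: c_def field_simps)
  finally have "measure ?M BB \<le> \<epsilon>" .
  moreover have "BB \<in> sets ?M"
    unfolding BB_def using T(1) by auto
  moreover have "dist (f x) (f y) < \<epsilon>"
    if x: "x \<in> space ?M - BB" and y: "y \<in> space ?M - BB" and xy: "same_cells U k N x y" for x y
  proof -
    obtain t where t: "t \<in> T" "f x \<in> ball t (\<epsilon>/2)"
      using T(2) by blast
    have "x \<in> D t"
      using f_D[of x t] t x by (auto simp: BB_def)
    then have "y \<in> D t"
      using cells[of x t y] y same_cells_mono[OF xy N[OF t(1)]] by auto
    then have "f y \<in> ball t (\<epsilon>/2)"
      using f_D[of y t] t y by (auto simp: BB_def)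
    then show ?thesis
      using t(2) dist_triangle_half_r[of t "f x" \<epsilon> "f y"] by (auto simp: dist_commute)
  qed
  ultimately show ?thesis
    by (intro exI[of _ N] bexI[of _ BB] conjI ballI impI)
qed

end

text \<open>A countable base of the topology generates the Borel sets, since every open set is a
  countable union of base sets.\<close>

lemma standard_measure_space_generators:
  assumes "standard_measure_space X" 
  obtains U :: "nat \<Rightarrow> 'a set" where "\<And>n. U n \<in> sets X"
    "\<And>A. A \<in> sets X \<Longrightarrow> \<exists>B\<in>sigma_sets (space X) (range U).
      \<exists>C\<in>sigma_sets (space X) (range U). B \<subseteq> A \<and> A \<subseteq> C \<and> C - B \<in> null_sets X"
proof -
  obtain T where T: "topspace T = space X" "second_countable T"
    "sigma_sets (space X) {U. openin T U} \<subseteq> sets X"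
    and sandwich: "\<And>A. A \<in> sets X \<Longrightarrow> \<exists>B\<in>sigma_sets (space X) {U. openin T U}.
                      \<exists>C\<in>sigma_sets (space X) {U. openin T U}.
                        B \<subseteq> A \<and> A \<subseteq> C \<and> C - B \<in> null_sets X"
    using assms unfolding standard_measure_space_def by metis
  obtain \<B> where \<B>: "countable \<B>" "\<And>V. V \<in> \<B> \<Longrightarrow> openin T V"
    "\<And>V x. openin T V \<Longrightarrow> x \<in> V \<Longrightarrow> \<exists>W\<in>\<B>. x \<in> W \<and> W \<subseteq> V"
    using T(2) unfolding second_countable_def by metis
  \<comment> \<open>Inserting \<open>{}\<close> makes the enumerated family nonempty, as
    \<open>range_from_nat_into\<close> demands.\<close>
  define U where "U = from_nat_into (insert {} \<B>)"
  have range: "range U = insert {} \<B>"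
    unfolding U_def using \<B>(1) by (intro range_from_nat_into) auto
  have "sigma_sets (space X) {U. openin T U} \<subseteq> sigma_sets (space X) (range U)"
  proof (rule sigma_sets_mono, rule subsetI)
    fix V assume "V \<in> {U. openin T U}"
    then have "V = \<Union>{W\<in>\<B>. W \<subseteq> V}"
      using \<B>(3) by blast
    moreover have "\<Union>{W\<in>\<B>. W \<subseteq> V} \<in> sigma_sets (space X) (range U)"
      using \<B>(1) by (intro sigma_sets_UNION) (auto simp: range)
    ultimately show "V \<in> sigma_sets (space X) (range U)" by simp
  qed
  moreover have "U n \<in> sets X" for n
  proof -
    have "U n \<in> insert {} \<B>" using range by blast
    then have "openin T (U n)" using \<B>(2) by auto
    then show ?thesis using T(3) by blast
  qed
  ultimately show ?thesis
    by (intro that[of U]) (assumption, meson sandwich subsetD)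
qed

subsection \<open>Random sampling from cells\<close>

text \<open>Fubini: almost every section of a null set at coordinate \<open>i\<close> is null in the
  remaining coordinates. By absolute continuity "almost every" may be read for \<open>N\<close>
  instead of \<open>M i\<close>, and integrating back gives a null set of the changed
  product.\<close>

lemma AE_PiM_change_component:
  assumes M: "\<And>j. j \<in> I \<Longrightarrow> prob_space (M j)" and N: "prob_space N" and i: "i \<in> I"
    and sets: "sets N = sets (M i)" and ac: "absolutely_continuous (M i) N"
    and P: "AE x in PiM I M. P x"
  shows "AE x in PiM I (M(i := N)). P x"
proof -
  let ?J = "I - {i}"
  let ?upd = "\<lambda>(a, Y). Y(i := a)"
  have I: "insert i ?J = I" using i by auto
  interpret J: prob_space "PiM ?J M" using M by (intro prob_space_PiM) auto
  interpret Mi: prob_space "M i" using M i by auto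
  interpret N: prob_space N by fact
  interpret MJ: pair_sigma_finite "M i" "PiM ?J M" ..
  interpret NJ: pair_sigma_finite N "PiM ?J M" ..
  have M_split: "distr (M i \<Otimes>\<^sub>M PiM ?J M) (PiM I M) ?upd = PiM I M"
    using distr_pair_PiM_eq_PiM[of ?J M i] M i by (simp add: I insert_absorb)
  have J_eq: "PiM ?J (M(i := N)) = PiM ?J M"
    by (intro PiM_cong) auto
  have N_split: "distr (N \<Otimes>\<^sub>M PiM ?J M) (PiM I (M(i := N))) ?upd = PiM I (M(i := N))"
  proof -
    have "distr ((M(i := N)) i \<Otimes>\<^sub>M PiM ?J (M(i := N))) (PiM (insert i ?J) (M(i := N))) ?upd
        = PiM (insert i ?J) (M(i := N))"
      using M N by (intro distr_pair_PiM_eq_PiM) auto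
    then show ?thesis by (simp only: I J_eq fun_upd_same)
  qed
  \<comment> \<open>The failure set of \<open>P\<close> need not be measurable. A measurable null
    set covering it is, as is required for returning from the iterated statement to the
    product.\<close>
  obtain Z where Z: "Z \<in> null_sets (PiM I M)" "{x \<in> space (PiM I M). \<not> P x} \<subseteq> Z"
    using P by (auto simp: eventually_ae_filter)
  have sets_eq: "sets (PiM I (M(i := N))) = sets (PiM I M)"
    using sets by (intro sets_PiM_cong) auto
  have upd_M[measurable]: "?upd \<in> M i \<Otimes>\<^sub>M PiM ?J M \<rightarrow>\<^sub>M PiM I M"
    unfolding split_beta' using i by (intro measurable_fun_upd[of _ ?J]) auto
  have pair_sets: "sets (N \<Otimes>\<^sub>M PiM ?J M) = sets (M i \<Otimes>\<^sub>M PiM ?J M)"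
    using sets by (intro sets_pair_measure_cong) auto
  have upd_N: "?upd \<in> N \<Otimes>\<^sub>M PiM ?J M \<rightarrow>\<^sub>M PiM I (M(i := N))"
    using upd_M measurable_cong_sets[OF pair_sets sets_eq] by blast
  have [measurable]: "Z \<in> sets (PiM I M)" using Z by auto
  have "AE x in distr (M i \<Otimes>\<^sub>M PiM ?J M) (PiM I M) ?upd. x \<notin> Z"
    unfolding M_split using Z AE_not_in by blast
  then have "AE z in M i \<Otimes>\<^sub>M PiM ?J M. ?upd z \<notin> Z"
    by (rule AE_distrD[OF upd_M])
  then have "AE a in M i. AE Y in PiM ?J M. ?upd (a, Y) \<notin> Z"
    by (rule MJ.AE_pair)
  then have "AE a in N. AE Y in PiM ?J M. ?upd (a, Y) \<notin> Z"
    by (rule absolutely_continuous_AE[OF sets ac])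
  moreover have "{z \<in> space (N \<Otimes>\<^sub>M PiM ?J M). ?upd z \<notin> Z} \<in> sets (N \<Otimes>\<^sub>M PiM ?J M)"
  proof -
    have "{z \<in> space (M i \<Otimes>\<^sub>M PiM ?J M). ?upd z \<notin> Z} \<in> sets (M i \<Otimes>\<^sub>M PiM ?J M)"
      by measurable
    then show ?thesis using pair_sets sets_eq_imp_space_eq[OF pair_sets] by simp
  qed
  ultimately have "AE z in N \<Otimes>\<^sub>M PiM ?J M. ?upd z \<notin> Z"
    by (intro NJ.AE_pair_measure)
  moreover have "{x \<in> space (PiM I (M(i := N))). x \<notin> Z} \<in> sets (PiM I (M(i := N)))"
  proof -
    have "{x \<in> space (PiM I M). x \<notin> Z} \<in> sets (PiM I M)" by measurable
    then show ?thesis using sets_eq sets_eq_imp_space_eq[OF sets_eq] by simp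
  qed
  ultimately have "AE x in distr (N \<Otimes>\<^sub>M PiM ?J M) (PiM I (M(i := N))) ?upd. x \<notin> Z"
    by (subst AE_distr_iff[OF upd_N])
  then have "AE x in PiM I (M(i := N)). x \<notin> Z"
    unfolding N_split .
  moreover have "AE x in PiM I (M(i := N)). x \<in> space (PiM I (M(i := N)))"
    by (rule AE_space)
  ultimately show ?thesis
    by eventually_elim (use Z(2) sets_eq_imp_space_eq[OF sets_eq] in auto)
qed

text \<open>One factor is changed at a time. Finiteness of \<open>J\<close> is essential: infinitely
  many absolutely continuous changes can produce a product measure singular to the original
  one.\<close>

lemma AE_PiM_change_finitely_many:
  assumes M: "\<And>j. j \<in> I \<Longrightarrow> prob_space (M j)" and N: "\<And>j. j \<in> J \<Longrightarrow> prob_space (N j)"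
    and J: "finite J" "J \<subseteq> I"
    and sets: "\<And>j. j \<in> J \<Longrightarrow> sets (N j) = sets (M j)"
    and ac: "\<And>j. j \<in> J \<Longrightarrow> absolutely_continuous (M j) (N j)"
    and P: "AE x in PiM I M. P x"
  shows "AE x in PiM I (\<lambda>j. if j \<in> J then N j else M j). P x"
  using J(1,2) N sets ac
proof (induction J)
  case empty
  have "(\<lambda>j. if j \<in> {} then N j else M j) = M" by auto
  then show ?case using P by (simp only:)
next
  case (insert i J)
  let ?M = "\<lambda>j. if j \<in> J then N j else M j"
  have "AE x in PiM I (?M(i := N i)). P x"
    using insert M by (intro AE_PiM_change_component) auto
  moreover have "?M(i := N i) = (\<lambda>j. if j \<in> insert i J then N j else M j)"
    by auto
  ultimately show ?case by (simp only:)
qed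

text \<open>Level \<open>0\<close> is reserved: its sample points are drawn from \<^term>\<open>X\<close> itself and only serve to extend
  finite lists of samples to sequences, while \<open>N i = 0\<close> in \<open>resample\<close> leaves the coordinate \<open>i\<close>
  unchanged.\<close>

definition cell_measure :: "'a measure \<Rightarrow> (nat \<Rightarrow> 'a \<Rightarrow> nat) \<Rightarrow> nat \<times> nat \<Rightarrow> 'a measure" where
  "cell_measure X \<kappa> p =
    (let A = {x \<in> space X. \<kappa> (fst p) x = snd p}
     in if fst p = 0 \<or> emeasure X A = 0 then X else uniform_measure X A)"

definition resample ::
    "nat \<Rightarrow> (nat \<Rightarrow> 'a \<Rightarrow> nat) \<Rightarrow> (nat \<Rightarrow> nat) \<Rightarrow> (nat \<times> nat \<Rightarrow> 'a) \<Rightarrow> (nat \<Rightarrow> 'a) \<Rightarrow> (nat \<Rightarrow> 'a)" where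
  "resample k \<kappa> N w x = (\<lambda>i\<in>{..<k}. if N i = 0 then x i else w (N i, \<kappa> (N i) (x i)))"

section \<open>Invariance of the law under resampling\<close>

context
  fixes X :: "'a measure" and \<kappa> :: "nat \<Rightarrow> 'a \<Rightarrow> nat" and k :: nat
  assumes X: "prob_space X" and \<kappa>[measurable]: "\<And>n. \<kappa> n \<in> X \<rightarrow>\<^sub>M count_space UNIV"
begin

interpretation X: prob_space X by fact
interpretation P: prob_space "tuple_space k X"
  using X by (intro prob_space_PiM) auto

lemma sets_cell_measure[measurable_cong]: "sets (cell_measure X \<kappa> p) = sets X"
  by (simp add: cell_measure_def Let_def)

lemma space_cell_measure[simp]: "space (cell_measure X \<kappa> p) = space X"
  using sets_cell_measure by (rule sets_eq_imp_space_eq)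

lemma prob_space_cell_measure: "prob_space (cell_measure X \<kappa> p)"
  unfolding cell_measure_def Let_def
  using X by (auto intro!: prob_space_uniform_measure)

text \<open>A uniform measure on a cell has a density, and level 0 and null cells fall back to
  \<open>X\<close>. Hence what holds for almost all sequences also holds when finitely many terms
  are drawn from cells.\<close>

lemma absolutely_continuous_cell_measure: "absolutely_continuous X (cell_measure X \<kappa> p)"
  unfolding absolutely_continuous_def cell_measure_def Let_def
  by (auto simp: null_sets_def emeasure_uniform_measure) 
    (metis (no_types, lifting) Int_lower2 emeasure_eq_0 ennreal_zero_divide)

interpretation W: product_prob_space "cell_measure X \<kappa>" UNIV
  by (intro product_prob_spaceI prob_space_cell_measure)

text \<open>Law of total probability: choosing a cell by means of a random point \<open>t\<close>
  and then a fresh point uniformly in that cell yields the law \<open>X\<close>. Null cells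
  contribute zero to both sides.\<close>

lemma nn_integral_cell_measure:
  assumes n: "n \<noteq> 0" and A[measurable]: "A \<in> sets X"
  shows "(\<integral>\<^sup>+ t. emeasure (cell_measure X \<kappa> (n, \<kappa> n t)) A \<partial>X) = emeasure X A"
proof -
  let ?C = "\<lambda>c. {x \<in> space X. \<kappa> n x = c}"
  have cell: "emeasure (cell_measure X \<kappa> (n, c)) A * emeasure X (?C c) = emeasure X (A \<inter> ?C c)" for c
  proof (cases "emeasure X (?C c) = 0")
    case True
    then have "emeasure X (A \<inter> ?C c) = 0"
      by (intro emeasure_eq_0[OF _ True]) auto
    then show ?thesis using True by simp
  next
    case False
    then show ?thesis
      using n by (simp add: cell_measure_def emeasure_uniform_measure Int_commute
          ennreal_divide_times ennreal_divide_self less_top[symmetric])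
  qed
  have "(\<integral>\<^sup>+ t. emeasure (cell_measure X \<kappa> (n, \<kappa> n t)) A \<partial>X)
      = (\<integral>\<^sup>+ t. (\<Sum>c. emeasure (cell_measure X \<kappa> (n, c)) A * indicator (?C c) t) \<partial>X)"
  proof (intro nn_integral_cong)
    fix t assume "t \<in> space X"
    then have "(\<Sum>c. emeasure (cell_measure X \<kappa> (n, c)) A * indicator (?C c) t)
        = (\<Sum>c\<in>{\<kappa> n t}. emeasure (cell_measure X \<kappa> (n, c)) A * indicator (?C c) t)"
      by (intro suminf_finite) auto
    then show "emeasure (cell_measure X \<kappa> (n, \<kappa> n t)) A =
        (\<Sum>c. emeasure (cell_measure X \<kappa> (n, c)) A * indicator (?C c) t)"
      using \<open>t \<in> space X\<close> by simp
  qed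
  also have "\<dots> = (\<Sum>c. \<integral>\<^sup>+ t. emeasure (cell_measure X \<kappa> (n, c)) A * indicator (?C c) t \<partial>X)"
    by (intro nn_integral_suminf) measurable
  also have "\<dots> = (\<Sum>c. emeasure X (A \<inter> ?C c))"
    by (simp add: nn_integral_cmult_indicator cell)
  also have "\<dots> = emeasure X (\<Union>c. A \<inter> ?C c)"
    by (intro suminf_emeasure) (auto simp: disjoint_family_on_def)
  also have "(\<Union>c. A \<inter> ?C c) = A"
    using sets.sets_into_space[OF A] by auto
  finally show ?thesis .
qed

lemma measurable_resample[measurable]:
  "(\<lambda>(w, x). resample k \<kappa> N w x) \<in> PiM UNIV (cell_measure X \<kappa>) \<Otimes>\<^sub>M tuple_space k X \<rightarrow>\<^sub>M tuple_space k X"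
  unfolding resample_def split_beta'
proof (rule measurable_restrict)
  fix i assume i: "i \<in> {..<k}"
  have 1[measurable]: "(\<lambda>z. snd z i) \<in> PiM UNIV (cell_measure X \<kappa>) \<Otimes>\<^sub>M tuple_space k X \<rightarrow>\<^sub>M X"
    using i by measurable
  have 2[measurable]: "(\<lambda>z. fst z p) \<in> PiM UNIV (cell_measure X \<kappa>) \<Otimes>\<^sub>M tuple_space k X \<rightarrow>\<^sub>M X" for p
  proof -
    have "(\<lambda>w. w p) \<in> PiM UNIV (cell_measure X \<kappa>) \<rightarrow>\<^sub>M X"
      using measurable_component_singleton[of p UNIV "cell_measure X \<kappa>"]
      by (simp add: measurable_cong_sets[OF refl sets_cell_measure])
    then show ?thesis by measurable
  qed
  \<comment> \<open>The index at which the sample is read depends on the tuple, but takes only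
    countably many values.\<close>
  have "(\<lambda>z. fst z (N i, \<kappa> (N i) (snd z i))) \<in> PiM UNIV (cell_measure X \<kappa>) \<Otimes>\<^sub>M tuple_space k X \<rightarrow>\<^sub>M X"
    by (rule measurable_compose_countable[where g="\<lambda>z. \<kappa> (N i) (snd z i)" and f="\<lambda>c z. fst z (N i, c)"]) measurable
  then show "(\<lambda>z. if N i = 0 then snd z i else fst z (N i, \<kappa> (N i) (snd z i)))
      \<in> PiM UNIV (cell_measure X \<kappa>) \<Otimes>\<^sub>M tuple_space k X \<rightarrow>\<^sub>M X"
    by simp
qed

text \<open>Given \<open>x\<close>, distinct levels make the indices of the samples distinct, so the
  new coordinates are conditionally independent. Independence of the \<open>x i\<close> then factors
  the integral over \<open>x\<close>, and each factor is the total probability of a single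
  coordinate.\<close>

lemma distr_resample:
  assumes N: "inj_on N {i. i < k \<and> N i \<noteq> 0}"
  shows "distr (PiM UNIV (cell_measure X \<kappa>) \<Otimes>\<^sub>M tuple_space k X) (tuple_space k X)
      (\<lambda>(w, x). resample k \<kappa> N w x) = tuple_space k X"
proof -
  let ?W = "PiM UNIV (cell_measure X \<kappa>)" and ?M = "tuple_space k X"
  let ?T = "\<lambda>(w, x). resample k \<kappa> N w x"
  interpret W: prob_space ?W by (intro prob_space_PiM prob_space_cell_measure)
  interpret WP: pair_sigma_finite ?W ?M ..
  interpret S: product_sigma_finite "\<lambda>_. X" ..
  show ?thesis
  proof (rule S.PiM_eqI)
    fix A assume A: "\<And>i. i \<in> {..<k} \<Longrightarrow> A i \<in> sets X"
    \<comment> \<open>The conditional probability, given \<open>x i = t\<close>, that coordinate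
      \<open>i\<close> of the resampled tuple lies in \<open>A i\<close>.\<close>
    define g where "g i t = (if N i = 0 then indicator (A i) t
      else emeasure (cell_measure X \<kappa> (N i, \<kappa> (N i) t)) (A i))" for i t
    define I1 where "I1 = {i. i < k \<and> N i \<noteq> 0}"
    have fib: "emeasure ?W ((\<lambda>w. (w, x)) -` (?T -` (PiE {..<k} A) \<inter> space (?W \<Otimes>\<^sub>M ?M))) = (\<Prod>i<k. g i (x i))"
      if x: "x \<in> space ?M" for x
    proof -
      define p where "p i = (N i, \<kappa> (N i) (x i))" for i
      have inj: "inj_on p I1"
        using N by (auto simp: inj_on_def p_def I1_def)
      have eq: "(\<lambda>w. (w, x)) -` (?T -` (PiE {..<k} A) \<inter> space (?W \<Otimes>\<^sub>M ?M)) =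
        {w \<in> space ?W. \<forall>i<k. if N i = 0 then x i \<in> A i else w (p i) \<in> A i}"
      proof -
        have "resample k \<kappa> N w x \<in> PiE {..<k} A \<longleftrightarrow> (\<forall>i<k. if N i = 0 then x i \<in> A i else w (p i) \<in> A i)" for w
          unfolding resample_def p_def restrict_PiE_iff by auto
        then show ?thesis using x by (simp add: space_pair_measure vimage_def Int_def conj_commute)
      qed
      show ?thesis
      proof (cases "\<forall>i<k. N i = 0 \<longrightarrow> x i \<in> A i")
        case False
        then obtain i where "i < k" "N i = 0" "x i \<notin> A i" by auto
        then have "(\<Prod>i<k. g i (x i)) = 0"
          by (intro prod_zero bexI[of _ i]) (auto simp: g_def)
        moreover have "{w \<in> space ?W. \<forall>i<k. if N i = 0 then x i \<in> A i else w (p i) \<in> A i} = {}"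
          using False by auto
        ultimately show ?thesis unfolding eq by (metis emeasure_empty)
      next
        case True
        \<comment> \<open>Since \<open>p\<close> is injective on the replaced coordinates, the event
          prescribes one set for each sample index, and its probability is a product.\<close>
        have "{w \<in> space ?W. \<forall>i<k. if N i = 0 then x i \<in> A i else w (p i) \<in> A i}
          = {w \<in> space ?W. \<forall>q\<in>p ` I1. w q \<in> A (the_inv_into I1 p q)}"
          using True inj by (auto simp: the_inv_into_f_f I1_def)
        also have "emeasure ?W \<dots> = (\<Prod>q\<in>p ` I1. emeasure (cell_measure X \<kappa> q) (A (the_inv_into I1 p q)))"
          using A inj by (intro W.emeasure_PiM_Collect)
            (auto simp: I1_def sets_cell_measure the_inv_into_f_f)
        also have "\<dots> = (\<Prod>i\<in>I1. emeasure (cell_measure X \<kappa> (p i)) (A i))"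
          using inj by (subst prod.reindex) (auto intro!: prod.cong simp: the_inv_into_f_f)
        also have "\<dots> = (\<Prod>i\<in>I1. g i (x i))"
          by (intro prod.cong) (auto simp: g_def I1_def p_def)
        also have "\<dots> = (\<Prod>i<k. g i (x i))"
          using True by (intro prod.mono_neutral_left) (auto simp: I1_def g_def)
        finally show ?thesis unfolding eq .
      qed
    qed
    have [measurable]: "PiE {..<k} A \<in> sets ?M"
      using A by (intro sets_PiM_I_finite) auto
    have "emeasure (distr (?W \<Otimes>\<^sub>M ?M) ?M ?T) (PiE {..<k} A)
        = emeasure (?W \<Otimes>\<^sub>M ?M) (?T -` (PiE {..<k} A) \<inter> space (?W \<Otimes>\<^sub>M ?M))"
      by (intro emeasure_distr) measurable
    also have "\<dots> = (\<integral>\<^sup>+ x. emeasure ?W ((\<lambda>w. (w, x)) -` (?T -` (PiE {..<k} A) \<inter> space (?W \<Otimes>\<^sub>M ?M))) \<partial>?M)"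
      by (intro WP.emeasure_pair_measure_alt2) measurable
    also have "\<dots> = (\<integral>\<^sup>+ x. (\<Prod>i<k. g i (x i)) \<partial>?M)"
      by (intro nn_integral_cong fib)
    also have "\<dots> = (\<Prod>i<k. \<integral>\<^sup>+ t. g i t \<partial>X)"
    proof (rule S.product_nn_integral_prod)
      show "g i \<in> borel_measurable X" if "i \<in> {..<k}" for i
      proof -
        have "(\<lambda>t. emeasure (cell_measure X \<kappa> (N i, \<kappa> (N i) t)) (A i)) \<in> borel_measurable X"
          by (rule measurable_compose[OF \<kappa>]) simp
        then show ?thesis
          using A[OF that] unfolding g_def by (cases "N i = 0") auto
      qed
    qed simp
    also have "\<dots> = (\<Prod>i<k. emeasure X (A i))"
    proof (rule prod.cong[OF refl])
      show "(\<integral>\<^sup>+ t. g i t \<partial>X) = emeasure X (A i)" if "i \<in> {..<k}" for i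
        using A[OF that] unfolding g_def by (cases "N i = 0") (simp_all add: nn_integral_cell_measure)
    qed
    finally show "emeasure (distr (?W \<Otimes>\<^sub>M ?M) ?M ?T) (PiE {..<k} A) = (\<Prod>i\<in>{..<k}. emeasure X (A i))" .
  qed auto
qed

end

section \<open>Almost sure properties of the drawn points\<close>

context
  fixes X :: "'a measure" and \<kappa> :: "nat \<Rightarrow> 'a \<Rightarrow> nat" and k :: nat
  assumes X: "prob_space X" and \<kappa>[measurable]: "\<And>n. \<kappa> n \<in> X \<rightarrow>\<^sub>M count_space UNIV"
begin

interpretation X: prob_space X by fact
interpretation P: prob_space "tuple_space k X"
  using X by (intro prob_space_PiM) auto
interpretation W: prob_space "PiM UNIV (cell_measure X \<kappa>)"
  by (intro prob_space_PiM prob_space_cell_measure X \<kappa>)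
interpretation WP: pair_prob_space "PiM UNIV (cell_measure X \<kappa>)" "tuple_space k X" ..

text \<open>The listed samples followed by the level 0 samples \<open>(0, i)\<close> occupy distinct
  indices, hence are independent. Level 0 samples have law \<open>X\<close>, so the law of the whole
  sequence differs from \<open>seq_space X\<close> in finitely many factors only.\<close>

lemma AE_sample_extends_to_sequence:
  assumes P: "AE y in seq_space X. P y" and l: "distinct l" "\<And>q. q \<in> set l \<Longrightarrow> fst q \<noteq> 0"
  shows "AE w in PiM UNIV (cell_measure X \<kappa>). P (\<lambda>i. w (if i < length l then l ! i else (0, i)))"
proof -
  define s where "s i = (if i < length l then l ! i else (0, i))" for i
  have l': "fst (l ! i) \<noteq> 0" if "i < length l" for i
    using l(2) that by auto
  have fst_s: "fst (s i) \<noteq> 0 \<longleftrightarrow> i < length l" for i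
    using l' by (simp add: s_def)
  have inj: "inj s"
  proof (rule injI)
    fix i j assume ij: "s i = s j"
    then have "i < length l \<longleftrightarrow> j < length l" by (metis fst_s)
    with ij show "i = j"
      using l(1) by (auto simp: s_def nth_eq_iff_index_eq split: if_splits)
  qed
  have "AE y in PiM UNIV (\<lambda>i. if i \<in> {..<length l} then cell_measure X \<kappa> (s i) else X). P y"
    using P by (intro AE_PiM_change_finitely_many X prob_space_cell_measure \<kappa> sets_cell_measure
        absolutely_continuous_cell_measure) auto
  moreover have "(\<lambda>i. if i \<in> {..<length l} then cell_measure X \<kappa> (s i) else X) = (\<lambda>i. cell_measure X \<kappa> (s i))"
    by (auto simp: s_def cell_measure_def)
  ultimately have "AE y in PiM UNIV (\<lambda>i. cell_measure X \<kappa> (s i)). P y"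
    by (simp only:)
  then have "AE y in distr (PiM UNIV (cell_measure X \<kappa>)) (PiM UNIV (\<lambda>i. cell_measure X \<kappa> (s i)))
      (\<lambda>w. \<lambda>i\<in>UNIV. w (s i)). P y"
    by (subst distr_PiM_reindex) (auto intro: inj prob_space_cell_measure X)
  moreover have "(\<lambda>w. \<lambda>i\<in>UNIV. w (s i))
      \<in> PiM UNIV (cell_measure X \<kappa>) \<rightarrow>\<^sub>M PiM UNIV (\<lambda>i. cell_measure X \<kappa> (s i))"
    by (intro measurable_restrict measurable_component_singleton) auto
  ultimately have w_AE: "AE w in PiM UNIV (cell_measure X \<kappa>). P (\<lambda>i\<in>UNIV. w (s i))"
    using AE_distrD by blast
  then show ?thesis by (simp add: s_def restrict_def)
qed

text \<open>Borel--Cantelli: resampled tuples with distinct levels have the law of the original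
  tuple, so they hit \<open>B n\<close> with probability at most \<open>(1/2) ^ n\<close>, which is
  summable.\<close>

lemma AE_eventually_notin_resample:
  assumes B: "\<And>n. B n \<in> sets (tuple_space k X)" "\<And>n. measure (tuple_space k X) (B n) \<le> (1/2) ^ n"
    and N: "inj_on N {i. i < k \<and> N i \<noteq> 0}" and j: "j < k" "N j = 0"
  shows "AE z in PiM UNIV (cell_measure X \<kappa>) \<Otimes>\<^sub>M tuple_space k X. eventually (\<lambda>n.
      resample k \<kappa> N (fst z) (snd z) \<notin> B n \<and> resample k \<kappa> (N(j := n)) (fst z) (snd z) \<notin> B n) sequentially"
proof -
  let ?W = "PiM UNIV (cell_measure X \<kappa>)" and ?M = "tuple_space k X"
  let ?T = "\<lambda>N (w, x). resample k \<kappa> N w x"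
  note T = measurable_resample[OF X \<kappa>]
  have summable: "summable (\<lambda>n. measure ?M (B n))"
    by (rule summable_comparison_test'[OF summable_geometric[of "1/2::real"], of 0])
      (use B(2) in auto)
  have "AE x in ?M. eventually (\<lambda>n. x \<in> space ?M - B n) sequentially"
    using B(1) summable by (intro borel_cantelli_AE1) (auto simp: P.emeasure_eq_measure)
  then have "AE x in distr (?W \<Otimes>\<^sub>M ?M) ?M (?T N). eventually (\<lambda>n. x \<in> space ?M - B n) sequentially"
    by (simp only: distr_resample[OF X \<kappa> N])
  then have 1: "AE z in ?W \<Otimes>\<^sub>M ?M. eventually (\<lambda>n. ?T N z \<in> space ?M - B n) sequentially"
    by (rule AE_distrD[OF T])
  \<comment> \<open>The finitely many levels set aside include every \<open>n\<close> at which
    \<open>N(j := n)\<close> could repeat a level. The event \<open>A n\<close> is made empty there,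
    which does not affect a statement about all large \<open>n\<close>.\<close>
  define I where "I = insert 0 (N ` {..<k})"
  define A where "A n = (if n \<in> I then {} else ?T (N(j := n)) -` B n \<inter> space (?W \<Otimes>\<^sub>M ?M))" for n
  have A_sets: "A n \<in> sets (?W \<Otimes>\<^sub>M ?M)" for n
    unfolding A_def using measurable_sets[OF T B(1)] by auto
  have "measure (?W \<Otimes>\<^sub>M ?M) (A n) \<le> measure ?M (B n)" for n
  proof (cases "n \<in> I")
    case False
    have "inj_on (N(j := n)) {i. i < k \<and> (N(j := n)) i \<noteq> 0}"
      using N False j by (auto simp: inj_on_def I_def)
    from distr_resample[OF X \<kappa> this]
    have "measure ?M (B n) = measure (distr (?W \<Otimes>\<^sub>M ?M) ?M (?T (N(j := n)))) (B n)"
      by simp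
    also have "\<dots> = measure (?W \<Otimes>\<^sub>M ?M) (A n)"
      using False by (simp only: A_def measure_distr[OF T B(1)] if_False)
    finally show ?thesis by simp
  qed (simp add: A_def)
  then have "summable (\<lambda>n. measure (?W \<Otimes>\<^sub>M ?M) (A n))"
    by (intro summable_comparison_test'[OF summable, of 0]) auto
  then have A_AE: "AE z in ?W \<Otimes>\<^sub>M ?M. eventually (\<lambda>n. z \<in> space (?W \<Otimes>\<^sub>M ?M) - A n) sequentially"
    by (intro borel_cantelli_AE1 A_sets) (auto simp: WP.P.emeasure_eq_measure)
  have I: "eventually (\<lambda>n. n \<notin> I) sequentially"
    using eventually_gt_at_top[of "Max I"]
    by (rule eventually_mono) (auto simp: I_def dest: Max_ge[rotated])
  from A_AE have 2: "AE z in ?W \<Otimes>\<^sub>M ?M. eventually (\<lambda>n. ?T (N(j := n)) z \<notin> B n) sequentially"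
  proof (rule eventually_mono)
    fix z assume "eventually (\<lambda>n. z \<in> space (?W \<Otimes>\<^sub>M ?M) - A n) sequentially"
    from this I show "eventually (\<lambda>n. ?T (N(j := n)) z \<notin> B n) sequentially"
      by eventually_elim (auto simp: A_def)
  qed
  from 1 2 show ?thesis
  proof eventually_elim
    case (elim z)
    then show ?case by eventually_elim (auto simp: split_beta')
  qed
qed

lemma AE_in_cells:
  "AE w in PiM UNIV (cell_measure X \<kappa>). \<forall>n c. n \<noteq> 0 \<longrightarrow> emeasure X {x \<in> space X. \<kappa> n x = c} \<noteq> 0 \<longrightarrow>
    \<kappa> n (w (n, c)) = c"
  unfolding AE_all_countable
proof (intro allI impI AE_impI)
  fix n c assume *: "n \<noteq> 0" "emeasure X {x \<in> space X. \<kappa> n x = c} \<noteq> 0"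
  have "AE t in cell_measure X \<kappa> (n, c). \<kappa> n t = c"
  proof -
    have "cell_measure X \<kappa> (n, c) = uniform_measure X {x \<in> space X. \<kappa> n x = c}"
      using * by (simp add: cell_measure_def)
    then show ?thesis by (simp only:) (auto intro: AE_uniform_measureI)
  qed
  then show "AE w in PiM UNIV (cell_measure X \<kappa>). \<kappa> n (w (n, c)) = c"
    by (intro AE_PiM_component prob_space_cell_measure X \<kappa>) auto
qed

text \<open>Each level has countably many cells, so the union of the null ones is null. They must be
  avoided because a sample attached to a null cell is drawn from \<open>X\<close> and may lie
  outside that cell.\<close>

lemma AE_nonnull_cells:
  "AE x in tuple_space k X. \<forall>i\<in>{..<k}. \<forall>n. emeasure X {t \<in> space X. \<kappa> n t = \<kappa> n (x i)} \<noteq> 0"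
proof (intro AE_finite_allI)
  fix i assume i: "i \<in> {..<k}"
  have "AE t in X. \<forall>n c. \<kappa> n t = c \<longrightarrow> emeasure X {t \<in> space X. \<kappa> n t = c} \<noteq> 0"
    unfolding AE_all_countable
  proof (intro allI)
    fix n c
    show "AE t in X. \<kappa> n t = c \<longrightarrow> emeasure X {t \<in> space X. \<kappa> n t = c} \<noteq> 0"
    proof (cases "emeasure X {t \<in> space X. \<kappa> n t = c} = 0")
      case True
      then have "{t \<in> space X. \<kappa> n t = c} \<in> null_sets X" by auto
      from AE_not_in[OF this] AE_space show ?thesis by eventually_elim auto
    qed auto
  qed
  then have "AE t in X. \<forall>n. emeasure X {s \<in> space X. \<kappa> n s = \<kappa> n t} \<noteq> 0" by auto
  then show "AE x in tuple_space k X. \<forall>n. emeasure X {t \<in> space X. \<kappa> n t = \<kappa> n (x i)} \<noteq> 0"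
    using i X by (intro AE_PiM_component) auto
qed simp

text \<open>For large \<open>n\<close> the tuples resampled by \<open>N\<close> and by
  \<open>N(j := n)\<close> both avoid \<open>B n\<close>. They differ only in coordinate
  \<open>j\<close>, where the sample lies in the level \<open>n\<close> cell of \<open>x j\<close>,
  so their values are within \<open>(1/2) ^ n\<close>. Fubini puts the quantifier over
  \<open>w\<close> first, which allows a single \<open>w\<close> to be fixed later.\<close>

lemma AE_resample_tendsto:
  fixes f :: "(nat \<Rightarrow> 'a) \<Rightarrow> 'b::metric_space"
  assumes B: "\<And>n. B n \<in> sets (tuple_space k X)" "\<And>n. measure (tuple_space k X) (B n) \<le> (1/2) ^ n"
    and f: "\<And>n x y. x \<in> space (tuple_space k X) - B n \<Longrightarrow> y \<in> space (tuple_space k X) - B n \<Longrightarrow>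
      (\<And>i. i < k \<Longrightarrow> \<kappa> n (x i) = \<kappa> n (y i)) \<Longrightarrow> dist (f x) (f y) < (1/2) ^ n"
  shows "AE w in PiM UNIV (cell_measure X \<kappa>). AE x in tuple_space k X.
    \<forall>N j. inj_on N {i. i < k \<and> N i \<noteq> 0} \<longrightarrow> j < k \<longrightarrow> N j = 0 \<longrightarrow>
      (\<lambda>n. f (resample k \<kappa> (N(j := n)) w x)) \<longlonglongrightarrow> f (resample k \<kappa> N w x)"
proof -
  let ?W = "PiM UNIV (cell_measure X \<kappa>)" and ?M = "tuple_space k X"
  \<comment> \<open>Only the values of \<open>N\<close> below \<open>k\<close> matter to
    \<open>resample\<close>. Extensional \<open>N\<close> form a countable set, so the almost sure
    statements can be combined.\<close>
  let ?\<N> = "{..<k} \<rightarrow>\<^sub>E (UNIV :: nat set)"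
  have "countable ?\<N>" by (intro countable_PiE) auto
  then have "AE z in ?W \<Otimes>\<^sub>M ?M. \<forall>N\<in>?\<N>. \<forall>j. inj_on N {i. i < k \<and> N i \<noteq> 0} \<longrightarrow> j < k \<longrightarrow> N j = 0 \<longrightarrow>
      eventually (\<lambda>n. resample k \<kappa> N (fst z) (snd z) \<notin> B n \<and>
        resample k \<kappa> (N(j := n)) (fst z) (snd z) \<notin> B n) sequentially"
    by (simp only: AE_ball_countable AE_all_countable)
      (intro ballI allI AE_impI AE_eventually_notin_resample B)
  then have "AE w in ?W. AE x in ?M. \<forall>N\<in>?\<N>. \<forall>j. inj_on N {i. i < k \<and> N i \<noteq> 0} \<longrightarrow> j < k \<longrightarrow> N j = 0 \<longrightarrow>
      eventually (\<lambda>n. resample k \<kappa> N w x \<notin> B n \<and> resample k \<kappa> (N(j := n)) w x \<notin> B n) sequentially"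
    by (drule_tac WP.AE_pair) simp
  with AE_in_cells AE_space show ?thesis
  proof eventually_elim
    case w: (elim w)
    have w_space: "w p \<in> space X" for p
      using w(2) by (auto simp: space_PiM space_cell_measure[OF X \<kappa>])
    from w(3) AE_nonnull_cells AE_space show ?case
    proof eventually_elim
      case x: (elim x)
      have T_space: "resample k \<kappa> N w x \<in> space ?M" for N
        using w_space x(3) by (auto simp: resample_def space_PiM)
      show ?case
      proof (intro allI impI)
        fix N :: "nat \<Rightarrow> nat" and j
        assume N: "inj_on N {i. i < k \<and> N i \<noteq> 0}" and j: "j < k" "N j = 0"
        let ?N = "restrict N {..<k}"
        have resample_cong: "resample k \<kappa> N w x = resample k \<kappa> N' w x" if "\<And>i. i < k \<Longrightarrow> N i = N' i" for N N'
          using that by (auto simp: resample_def)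
        have "inj_on ?N {i. i < k \<and> ?N i \<noteq> 0}"
          using N by (auto simp: inj_on_def)
        then have "eventually (\<lambda>n. resample k \<kappa> ?N w x \<notin> B n \<and> resample k \<kappa> (?N(j := n)) w x \<notin> B n) sequentially"
          using x(1) j by auto
        also have "resample k \<kappa> ?N w x = resample k \<kappa> N w x"
          by (intro resample_cong) auto
        also have "(\<lambda>n. resample k \<kappa> (?N(j := n)) w x) = (\<lambda>n. resample k \<kappa> (N(j := n)) w x)"
          by (intro ext resample_cong) auto
        finally have "eventually (\<lambda>n. resample k \<kappa> N w x \<notin> B n \<and> resample k \<kappa> (N(j := n)) w x \<notin> B n) sequentially" .
        moreover have "eventually (\<lambda>n. n \<noteq> 0) sequentially"
          by (rule eventually_sequentiallyI[of 1]) auto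
        ultimately have "eventually (\<lambda>n. dist (f (resample k \<kappa> (N(j := n)) w x)) (f (resample k \<kappa> N w x)) < (1/2) ^ n) sequentially"
        proof eventually_elim
          case (elim n)
          have "\<kappa> n (w (n, \<kappa> n (x j))) = \<kappa> n (x j)"
            using w(1) x(2) elim(2) j by auto
          then show ?case
            using elim T_space j by (intro f DiffI) (blast, blast, blast, blast, simp add: resample_def)
        qed
        then have le: "eventually (\<lambda>n. dist (f (resample k \<kappa> (N(j := n)) w x)) (f (resample k \<kappa> N w x)) \<le> (1/2) ^ n) sequentially"
          by (rule eventually_mono) simp
        have lim: "(\<lambda>n. (1/2::real) ^ n) \<longlonglongrightarrow> 0"
          by (intro LIMSEQ_power_zero) simp
        have "(\<lambda>n. dist (f (resample k \<kappa> (N(j := n)) w x)) (f (resample k \<kappa> N w x))) \<longlonglongrightarrow> 0"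
          by (rule tendsto_sandwich[OF _ le tendsto_const lim]) simp
        then show "(\<lambda>n. f (resample k \<kappa> (N(j := n)) w x)) \<longlonglongrightarrow> f (resample k \<kappa> N w x)"
          by (rule tendsto_dist_iff[THEN iffD2])
      qed
    qed
  qed
qed

end

section \<open>Deterministic sampling maps\<close>

text \<open>The index is the binary code of the set of those \<open>j < n\<close> for which
  \<open>U j\<close> contains the point.\<close>

lemma cell_index:
  assumes U: "\<And>n::nat. U n \<in> sets X"
  obtains \<kappa> :: "nat \<Rightarrow> 'a \<Rightarrow> nat" where "\<And>n. \<kappa> n \<in> X \<rightarrow>\<^sub>M count_space UNIV"
    "\<And>n x y. \<kappa> n x = \<kappa> n y \<Longrightarrow> \<forall>j<n. x \<in> U j \<longleftrightarrow> y \<in> U j"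
proof
  let ?\<kappa> = "\<lambda>n x. \<Sum>j<n. if x \<in> U j then 2 ^ j else 0 :: nat"
  show "?\<kappa> n \<in> X \<rightarrow>\<^sub>M count_space UNIV" for n
    using U by measurable
  have eq: "?\<kappa> n x = set_encode {j. j < n \<and> x \<in> U j}" for n x
    unfolding set_encode_def by (subst sum.inter_filter[symmetric]) (auto intro!: sum.cong)
  show "\<forall>j<n. x \<in> U j \<longleftrightarrow> y \<in> U j" if "?\<kappa> n x = ?\<kappa> n y" for n x y
  proof -
    have "{j. j < n \<and> x \<in> U j} = {j. j < n \<and> y \<in> U j}"
      using that unfolding eq by (auto dest!: inj_onD[OF inj_on_set_encode])
    then show ?thesis by blast
  qed
qed

text \<open>These are the good tuples. As \<open>\<phi> 0\<close> will be the identity, a level 0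
  marks a coordinate that has not been moved yet, so a tuple can be turned into a tuple of samples
  one coordinate at a time.\<close>

definition resampling_limit_point ::
    "nat \<Rightarrow> (nat \<Rightarrow> 'a \<Rightarrow> 'a) \<Rightarrow> ((nat \<Rightarrow> 'a) \<Rightarrow> 'b::metric_space) \<Rightarrow> (nat \<Rightarrow> 'a) \<Rightarrow> bool" where
  "resampling_limit_point k \<phi> f x \<longleftrightarrow>
    (\<forall>N j. inj_on N {i. i < k \<and> N i \<noteq> 0} \<longrightarrow> j < k \<longrightarrow> N j = 0 \<longrightarrow>
      (\<lambda>n. f (\<lambda>i\<in>{..<k}. \<phi> ((N(j := n)) i) (x i))) \<longlonglongrightarrow> f (\<lambda>i\<in>{..<k}. \<phi> (N i) (x i)))"

text \<open>Fixing one sample \<open>w\<close> outside a null set removes all randomness from the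
  rest of the argument. The property \<open>P\<close> is left open because it will also have to
  include symmetry.\<close>

lemma exists_sampling_maps:
  fixes f :: "(nat \<Rightarrow> 'a) \<Rightarrow> 'b::metric_space"
  assumes K: "compact (UNIV :: 'b set)" and X: "prob_space X" "standard_measure_space X"
    and f: "tuple_measurable k X f" and P: "AE y in seq_space X. P y"
  shows "\<exists>\<phi>. (\<forall>x. \<phi> 0 x = x) \<and>
    (\<forall>m (n :: nat \<Rightarrow> nat) y. inj_on n {..<m} \<longrightarrow> (\<forall>i<m. n i \<noteq> 0) \<longrightarrow>
      (\<exists>z. P z \<and> (\<forall>i<m. z i = \<phi> (n i) (y i)))) \<and>
    (AE x in tuple_space k X. resampling_limit_point k \<phi> f x)"
proof -
  interpret X: prob_space X by fact
  obtain U where U: "\<And>n::nat. U n \<in> sets X"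
    "\<And>A. A \<in> sets X \<Longrightarrow> \<exists>B\<in>sigma_sets (space X) (range U).
      \<exists>C\<in>sigma_sets (space X) (range U). B \<subseteq> A \<and> A \<subseteq> C \<and> C - B \<in> null_sets X"
    by (rule standard_measure_space_generators[OF X(2)], rule that)
  define Q where "Q m n B \<longleftrightarrow> B \<in> sets (tuple_space k X) \<and> measure (tuple_space k X) B \<le> (1/2) ^ m \<and>
    (\<forall>x\<in>space (tuple_space k X) - B. \<forall>y\<in>space (tuple_space k X) - B.
      same_cells U k n x y \<longrightarrow> dist (f x) (f y) < (1/2) ^ m)" for m n B
  have "\<exists>n B. Q m n B" for m
    using cells_nearly_determine_function[OF X(1) U K f, of "(1/2) ^ m"] unfolding Bex_def Q_def by simp
  then obtain l B where Q: "\<And>m. Q m (l m) (B m)"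
    by metis
  have B: "\<And>m. B m \<in> sets (tuple_space k X)" "\<And>m. measure (tuple_space k X) (B m) \<le> (1/2) ^ m"
    and fB: "\<And>m x y. x \<in> space (tuple_space k X) - B m \<Longrightarrow> y \<in> space (tuple_space k X) - B m \<Longrightarrow>
      same_cells U k (l m) x y \<Longrightarrow> dist (f x) (f y) < (1/2) ^ m"
    using Q by (simp_all add: Q_def)
  obtain \<kappa>' :: "nat \<Rightarrow> 'a \<Rightarrow> nat" where \<kappa>': "\<And>n. \<kappa>' n \<in> X \<rightarrow>\<^sub>M count_space UNIV"
    "\<And>n x y. \<kappa>' n x = \<kappa>' n y \<Longrightarrow> \<forall>j<n. x \<in> U j \<longleftrightarrow> y \<in> U j"
    by (rule cell_index[of U X], rule U(1), rule that)
  \<comment> \<open>Level \<open>m\<close> uses as many generators as accuracy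
    \<open>(1/2) ^ m\<close> requires.\<close>
  define \<kappa> where "\<kappa> m = \<kappa>' (l m)" for m
  have \<kappa>: "\<And>n. \<kappa> n \<in> X \<rightarrow>\<^sub>M count_space UNIV"
    by (simp add: \<kappa>_def \<kappa>')
  have f\<kappa>: "dist (f x) (f y) < (1/2) ^ m"
    if xy: "x \<in> space (tuple_space k X) - B m" "y \<in> space (tuple_space k X) - B m"
      and eq: "\<And>i. i < k \<Longrightarrow> \<kappa> m (x i) = \<kappa> m (y i)" for m x y
  proof (rule fB[OF xy])
    show "same_cells U k (l m) x y"
      unfolding same_cells_def using \<kappa>'(2)[OF eq[unfolded \<kappa>_def]] by blast
  qed
  interpret W: prob_space "PiM UNIV (cell_measure X \<kappa>)"
    by (intro prob_space_PiM prob_space_cell_measure X \<kappa>)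
  have "AE w in PiM UNIV (cell_measure X \<kappa>). \<forall>l\<in>{l. distinct l \<and> (\<forall>q\<in>set l. fst q \<noteq> 0)}.
      P (\<lambda>i. w (if i < length l then l ! i else (0, i)))"
    by (subst AE_ball_countable) (auto intro: AE_sample_extends_to_sequence[OF X(1) \<kappa> P])
  moreover have "AE w in PiM UNIV (cell_measure X \<kappa>). AE x in tuple_space k X.
    \<forall>N j. inj_on N {i. i < k \<and> N i \<noteq> 0} \<longrightarrow> j < k \<longrightarrow> N j = 0 \<longrightarrow>
      (\<lambda>n. f (resample k \<kappa> (N(j := n)) w x)) \<longlonglongrightarrow> f (resample k \<kappa> N w x)"
    by (rule AE_resample_tendsto[OF X(1) \<kappa> B], rule f\<kappa>)
  ultimately have w_AE: "AE w in PiM UNIV (cell_measure X \<kappa>). (\<forall>l\<in>{l. distinct l \<and> (\<forall>q\<in>set l. fst q \<noteq> 0)}.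
      P (\<lambda>i. w (if i < length l then l ! i else (0, i)))) \<and>
    (AE x in tuple_space k X.
    \<forall>N j. inj_on N {i. i < k \<and> N i \<noteq> 0} \<longrightarrow> j < k \<longrightarrow> N j = 0 \<longrightarrow>
      (\<lambda>n. f (resample k \<kappa> (N(j := n)) w x)) \<longlonglongrightarrow> f (resample k \<kappa> N w x))"
    by eventually_elim (rule conjI)
  obtain w where w1: "\<And>l. distinct l \<Longrightarrow> \<forall>q\<in>set l. fst q \<noteq> 0 \<Longrightarrow>
      P (\<lambda>i. w (if i < length l then l ! i else (0, i)))"
    and w2: "AE x in tuple_space k X.
    \<forall>N j. inj_on N {i. i < k \<and> N i \<noteq> 0} \<longrightarrow> j < k \<longrightarrow> N j = 0 \<longrightarrow>
      (\<lambda>n. f (resample k \<kappa> (N(j := n)) w x)) \<longlonglongrightarrow> f (resample k \<kappa> N w x)"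
    using eventually_happens'[OF W.ae_filter_bot w_AE] by blast
  define \<phi> where "\<phi> n x = (if n = 0 then x else w (n, \<kappa> n x))" for n x
  have resample_eq: "resample k \<kappa> N w x = (\<lambda>i\<in>{..<k}. \<phi> (N i) (x i))" for N x
    by (auto simp: resample_def \<phi>_def)
  show ?thesis
  proof (intro exI[of _ \<phi>] conjI allI impI)
    show "\<phi> 0 x = x" for x by (simp add: \<phi>_def)
    show "AE x in tuple_space k X. resampling_limit_point k \<phi> f x"
      using w2 unfolding resample_eq resampling_limit_point_def .
    fix m and n :: "nat \<Rightarrow> nat" and y :: "nat \<Rightarrow> 'a"
    assume n: "inj_on n {..<m}" "\<forall>i<m. n i \<noteq> 0"
    \<comment> \<open>The sample indices are distinct because the levels are, even where the points
      \<open>y i\<close> coincide.\<close>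
    define l where "l = map (\<lambda>i. (n i, \<kappa> (n i) (y i))) [0..<m]"
    have "distinct l"
      using n(1) by (auto simp: l_def distinct_map inj_on_def)
    moreover have "\<forall>q\<in>set l. fst q \<noteq> 0"
      using n(2) by (auto simp: l_def)
    ultimately show "\<exists>z. P z \<and> (\<forall>i<m. z i = \<phi> (n i) (y i))"
      using w1[of l] n(2) by (intro exI[of _ "\<lambda>i. w (if i < length l then l ! i else (0, i))"])
        (auto simp: l_def \<phi>_def dest: n(2)[rule_format])
  qed
qed

subsection \<open>Compactness and Ramsey arguments\<close>

text \<open>Completeness of the measure. This is what makes functions obtained from a compactness
  argument, with no control of measurability, measurable after all.\<close>

lemma tuple_measurable_AE_cong:
  assumes f: "tuple_measurable k X f" and fg: "AE x in tuple_space k X. g x = f x"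
  shows "tuple_measurable k X g"
  unfolding tuple_measurable_def
proof (rule measurableI)
  let ?C = "completion (tuple_space k X)"
  fix A :: "'b set" assume A: "A \<in> sets borel"
  have "AE x in ?C. x \<in> f -` A \<inter> space ?C \<longleftrightarrow> x \<in> g -` A \<inter> space ?C"
    using AE_completion[OF fg] by eventually_elim auto
  then show "g -` A \<inter> space ?C \<in> sets ?C"
    by (rule completion.in_sets_AE)
      (use measurable_sets[OF f[unfolded tuple_measurable_def] A] in auto)
qed simp

lemma eq_of_dist_less_inverse_Suc:
  fixes a b :: "'a::metric_space"
  assumes "\<And>r. r \<ge> m \<Longrightarrow> dist a b < c / Suc r"
  shows "a = b"
proof -
  have "(\<lambda>r. c / real (Suc r)) \<longlonglongrightarrow> 0"
    using LIMSEQ_Suc[OF lim_const_over_n[of c]] .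
  then have "dist a b \<le> 0"
    by (rule LIMSEQ_le_const) (use assms in \<open>auto intro!: exI[of _ m] less_imp_le\<close>)
  then show ?thesis by simp
qed

section \<open>Cluster points and approximation in product topologies\<close>

lemma compact_UNIV_fun:
  assumes "compact (UNIV :: 'b::topological_space set)"
  shows "compact (UNIV :: ('i \<Rightarrow> 'b) set)"
proof -
  have "compact_space (euclidean :: 'b topology)"
    using assms by (simp add: compact_space_def)
  then have "compact_space (product_topology (\<lambda>_::'i. euclidean :: 'b topology) UNIV)"
    by (simp add: compact_space_product_topology)
  then show ?thesis
    by (simp add: euclidean_product_topology compact_space_def)
qed

text \<open>The sets \<open>C F r\<close> shrink as \<open>F\<close> and \<open>r\<close> grow, so
  by Tychonoff their closures have a common point \<open>g\<close>. Closeness at the finitely many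
  arguments in \<open>T\<close> describes a neighbourhood of \<open>g\<close>, which therefore meets
  each \<open>C F r\<close>.\<close>

lemma compact_cluster_function:
  fixes C :: "'a set \<Rightarrow> nat \<Rightarrow> ('i \<Rightarrow> 'b::metric_space) set"
  assumes K: "compact (UNIV :: 'b set)"
    and ne: "\<And>F r. finite F \<Longrightarrow> C F r \<noteq> {}"
    and anti: "\<And>F F' r r'. F \<subseteq> F' \<Longrightarrow> r \<le> r' \<Longrightarrow> C F' r' \<subseteq> C F r"
  obtains g where "\<And>F r T. finite F \<Longrightarrow> finite T \<Longrightarrow> \<exists>g'\<in>C F r. \<forall>t\<in>T. dist (g t) (g' t) < 1 / Suc r"
proof -
  let ?I = "{F :: 'a set. finite F} \<times> (UNIV :: nat set)"
  have "UNIV \<inter> (\<Inter>p\<in>?I. closure (C (fst p) (snd p))) \<noteq> {}"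
  proof (rule compact_imp_fip_image)
    show "compact (UNIV :: ('i \<Rightarrow> 'b) set)" by (rule compact_UNIV_fun[OF K])
    fix I' assume I': "finite I'" "I' \<subseteq> ?I"
    \<comment> \<open>A finite subfamily is dominated by the union of its first components and the
      largest of its second ones; 0 is inserted for the empty subfamily.\<close>
    define F where "F = (\<Union>p\<in>I'. fst p)"
    define r where "r = Max (insert 0 (snd ` I'))"
    have "finite F" using I' by (auto simp: F_def)
    then obtain g where g: "g \<in> C F r" using ne by blast
    have "g \<in> closure (C (fst p) (snd p))" if "p \<in> I'" for p
    proof -
      have "fst p \<subseteq> F" using that by (auto simp: F_def)
      moreover have "snd p \<le> r" using that I'(1) by (auto simp: r_def)
      ultimately show ?thesis using anti g closure_subset by blast
    qed
    then show "UNIV \<inter> (\<Inter>p\<in>I'. closure (C (fst p) (snd p))) \<noteq> {}" by blast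
  qed simp
  then obtain g where "g \<in> (\<Inter>p\<in>?I. closure (C (fst p) (snd p)))" by blast
  then have g: "g \<in> closure (C F r)" if "finite F" for F r
    using that by force
  show thesis
  proof (rule that)
    fix F :: "'a set" and r and T :: "'i set" assume F: "finite F" "finite T"
    define W where "W = (\<Inter>t\<in>T. (\<lambda>h. h t) -` ball (g t) (1 / Suc r))"
    have "open W"
      unfolding W_def using F(2)
      by (intro open_INT ballI open_vimage open_ball) (auto intro: continuous_on_product_coordinates)
    moreover have "g \<in> W" by (auto simp: W_def)
    ultimately obtain g' where g': "g' \<in> W" "g' \<in> C F r"
      using g[OF F(1)] open_Int_closure_eq_empty by blast
    have "\<forall>t\<in>T. dist (g t) (g' t) < 1 / Suc r"
      using g'(1) by (auto simp: W_def simp del: of_nat_Suc)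
    then show "\<exists>g'\<in>C F r. \<forall>t\<in>T. dist (g t) (g' t) < 1 / Suc r"
      using g'(2) by (rule bexI)
  qed
qed

text \<open>A basic neighbourhood restricts finitely many coordinates, so a point outside the closed
  set would be kept away from it by finitely many coordinates and one positive distance. Points of
  the product over \<open>D\<close> are extensional functions.\<close>

lemma closedin_product_approx:
  fixes M :: "('i \<Rightarrow> 'b::metric_space) set"
  assumes M: "closedin (product_topology (\<lambda>_. euclidean) D) M"
    and z: "z \<in> extensional D"
    and approx: "\<And>J r. finite J \<Longrightarrow> J \<subseteq> D \<Longrightarrow> \<exists>z'\<in>M. \<forall>i\<in>J. dist (z i) (z' i) < 1 / Suc r"
  shows "z \<in> M"
proof (rule ccontr)
  assume "z \<notin> M"
  let ?T = "product_topology (\<lambda>_. euclidean :: 'b topology) D"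
  have "openin ?T (topspace ?T - M)" using M by blast
  moreover have "z \<in> topspace ?T - M" using \<open>z \<notin> M\<close> z by (auto simp: PiE_def)
  ultimately obtain V where V: "z \<in> PiE D V" "\<And>i. open (V i)" "finite {i. V i \<noteq> UNIV}"
      "PiE D V \<subseteq> topspace ?T - M"
    using product_topology_open_contains_basis[of "\<lambda>_. euclidean" D "topspace ?T - M" z] by auto
  define J where "J = {i. V i \<noteq> UNIV} \<inter> D"
  have J: "finite J" "J \<subseteq> D" using V(3) by (auto simp: J_def)
  have "\<exists>r::nat. ball (z i) (1 / Suc r) \<subseteq> V i" if "i \<in> J" for i
  proof -
    have "z i \<in> V i" using V(1) that by (auto simp: J_def)
    then obtain \<epsilon> where "\<epsilon> > 0" "ball (z i) \<epsilon> \<subseteq> V i"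
      using V(2) open_contains_ball by blast
    moreover obtain r :: nat where "1 / Suc r < \<epsilon>"
      using \<open>\<epsilon> > 0\<close> nat_approx_posE by blast
    ultimately show ?thesis
      by (intro exI[of _ r]) (meson less_imp_le order_trans subset_ball)
  qed
  then obtain r where r: "\<And>i. i \<in> J \<Longrightarrow> ball (z i) (1 / Suc (r i)) \<subseteq> V i" by metis
  define R where "R = Max (insert 0 (r ` J))"
  have R: "r i \<le> R" if "i \<in> J" for i using that J(1) by (auto simp: R_def)
  obtain z' where z': "z' \<in> M" "\<And>i. i \<in> J \<Longrightarrow> dist (z i) (z' i) < 1 / Suc R"
    using approx[OF J] by blast
  have "z' \<in> PiE D V"
  proof (rule PiE_I)
    fix i assume i: "i \<in> D"
    show "z' i \<in> V i"
    proof (cases "i \<in> J")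
      case True
      have "1 / real (Suc R) \<le> 1 / Suc (r i)"
        using R[OF True] by (intro divide_left_mono) auto
      then have "z' i \<in> ball (z i) (1 / Suc (r i))"
        using z'(2)[OF True] by simp
      then show ?thesis using r[OF True] by blast
    qed (use i in \<open>auto simp: J_def\<close>)
  next
    fix i assume "i \<notin> D"
    moreover have "z' \<in> topspace ?T" using z'(1) closedin_subset[OF M] by blast
    ultimately show "z' i = undefined" by (auto simp: PiE_def extensional_def)
  qed
  then show False using V(4) z'(1) by blast
qed

text \<open>The levels are chosen one label at a time. In each step at most one coordinate of a tuple moves,
  and for a good tuple it moves by an arbitrarily small amount once the new level is large.\<close>

lemma choose_levels:
  fixes f :: "(nat \<Rightarrow> 'a) \<Rightarrow> 'b::metric_space" and pt :: "nat \<Rightarrow> 'a"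
  assumes \<phi>: "\<And>x. \<phi> 0 x = x" and H: "infinite H" and "\<epsilon> > 0"
  obtains n where "strict_mono_on {..<L} n" "n ` {..<L} \<subseteq> H"
    "\<And>e. e ` {..<k} \<subseteq> {..<L} \<Longrightarrow> inj_on e {..<k} \<Longrightarrow>
      resampling_limit_point k \<phi> f (\<lambda>j\<in>{..<k}. pt (e j)) \<Longrightarrow>
      dist (f (\<lambda>j\<in>{..<k}. \<phi> (n (e j)) (pt (e j)))) (f (\<lambda>j\<in>{..<k}. pt (e j))) < \<epsilon>"
proof -
  \<comment> \<open>Taking \<open>e\<close> extensional makes this set finite, so the thresholds for
    its members have a common upper bound.\<close>
  define E where "E = {e \<in> {..<k} \<rightarrow>\<^sub>E {..<L}. inj_on e {..<k} \<and>
    resampling_limit_point k \<phi> f (\<lambda>j\<in>{..<k}. pt (e j))}"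
  have "finite E" unfolding E_def by (intro finite_Collect_conjI disjI1) (simp add: finite_PiE)
  \<comment> \<open>The intermediate stage of the induction: coordinates whose label is below
    \<open>l\<close> have been replaced by samples, the others are still the original
    points.\<close>
  define moved where "moved l n e = (\<lambda>j\<in>{..<k}. \<phi> (if e j < l then n (e j) else 0) (pt (e j)))" for l n e
  have "\<exists>n. strict_mono_on {..<l} n \<and> n ` {..<l} \<subseteq> H \<and>
      (\<forall>e\<in>E. dist (f (moved l n e)) (f (\<lambda>j\<in>{..<k}. pt (e j))) < \<epsilon>)" for l
  proof (induction l)
    case 0
    then show ?case using \<open>\<epsilon> > 0\<close> by (auto simp: moved_def \<phi> strict_mono_on_def)
  next
    case (Suc l)
    then obtain n where n: "strict_mono_on {..<l} n" "n ` {..<l} \<subseteq> H"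
      and near: "\<And>e. e \<in> E \<Longrightarrow> dist (f (moved l n e)) (f (\<lambda>j\<in>{..<k}. pt (e j))) < \<epsilon>"
      by blast
    have "eventually (\<lambda>m. dist (f (moved (Suc l) (n(l := m)) e)) (f (\<lambda>j\<in>{..<k}. pt (e j))) < \<epsilon>) sequentially"
      if e: "e \<in> E" for e
    proof (cases "l \<in> e ` {..<k}")
      case False
      then have "moved (Suc l) (n(l := m)) e = moved l n e" for m
        by (auto simp: moved_def less_Suc_eq intro!: restrict_ext)
      then show ?thesis using near[OF e] by simp
    next
      case True
      then obtain j where j: "j < k" "e j = l" by auto
      have e_inj: "inj_on e {..<k}" using e by (simp add: E_def)
      define N where "N i = (if e i < l then n (e i) else 0)" for i
      have "inj_on n {..<l}" using n(1) by (rule strict_mono_on_imp_inj_on)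
      then have N_inj: "inj_on N {i. i < k \<and> N i \<noteq> 0}"
        using e_inj by (auto simp: inj_on_def N_def split: if_splits)
      have good: "resampling_limit_point k \<phi> f (\<lambda>j\<in>{..<k}. pt (e j))"
        using e by (simp add: E_def)
      have "N j = 0" using j by (simp add: N_def)
      from good[unfolded resampling_limit_point_def, rule_format, OF N_inj j(1) this]
      have lim: "(\<lambda>m. f (\<lambda>i\<in>{..<k}. \<phi> ((N(j := m)) i) ((\<lambda>j\<in>{..<k}. pt (e j)) i))) \<longlonglongrightarrow>
          f (\<lambda>i\<in>{..<k}. \<phi> (N i) ((\<lambda>j\<in>{..<k}. pt (e j)) i))"
        .
      have "(\<lambda>i\<in>{..<k}. \<phi> (N i) ((\<lambda>j\<in>{..<k}. pt (e j)) i)) = moved l n e"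
        by (auto simp: moved_def N_def)
      moreover have "(\<lambda>i\<in>{..<k}. \<phi> ((N(j := m)) i) ((\<lambda>j\<in>{..<k}. pt (e j)) i)) = moved (Suc l) (n(l := m)) e" for m
        using e_inj j by (auto simp: moved_def N_def less_Suc_eq inj_on_def intro!: restrict_ext)
      ultimately have "(\<lambda>m. f (moved (Suc l) (n(l := m)) e)) \<longlonglongrightarrow> f (moved l n e)"
        using lim by simp
      \<comment> \<open>The strict bound of the previous stage is an open condition, so convergence
        to the previous value preserves it for all large \<open>m\<close>.\<close>
      then have "(\<lambda>m. dist (f (moved (Suc l) (n(l := m)) e)) (f (\<lambda>j\<in>{..<k}. pt (e j))))
          \<longlonglongrightarrow> dist (f (moved l n e)) (f (\<lambda>j\<in>{..<k}. pt (e j)))"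
        by (intro tendsto_dist tendsto_const)
      then show ?thesis using near[OF e] by (rule order_tendstoD(2))
    qed
    then have "eventually (\<lambda>m. \<forall>e\<in>E. dist (f (moved (Suc l) (n(l := m)) e)) (f (\<lambda>j\<in>{..<k}. pt (e j))) < \<epsilon>) sequentially"
      using \<open>finite E\<close> by (simp add: eventually_ball_finite)
    then obtain m0 where m0: "\<And>m e. m \<ge> m0 \<Longrightarrow> e \<in> E \<Longrightarrow>
        dist (f (moved (Suc l) (n(l := m)) e)) (f (\<lambda>j\<in>{..<k}. pt (e j))) < \<epsilon>"
      by (auto simp: eventually_sequentially)
    obtain m where m: "m \<in> H" "m > Max (insert m0 (n ` {..<l}))"
      using H by (meson infinite_nat_iff_unbounded)
    have "m > m0" "\<And>i. i < l \<Longrightarrow> n i < m" using m(2) by auto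
    then have "strict_mono_on {..<Suc l} (n(l := m))"
      using n(1) by (auto simp: strict_mono_on_def less_Suc_eq)
    moreover have "(n(l := m)) ` {..<Suc l} \<subseteq> H" using n(2) m(1) by (auto simp: less_Suc_eq)
    ultimately show ?case
      using \<open>m > m0\<close> by (intro exI[of _ "n(l := m)"] conjI ballI m0) (assumption, assumption, simp, assumption)
  qed
  from this[of L] obtain n where n: "strict_mono_on {..<L} n" "n ` {..<L} \<subseteq> H"
    and near: "\<And>e. e \<in> E \<Longrightarrow> dist (f (moved L n e)) (f (\<lambda>j\<in>{..<k}. pt (e j))) < \<epsilon>"
    by blast
  show thesis
  proof (rule that[OF n])
    fix e :: "nat \<Rightarrow> nat"
    assume e: "e ` {..<k} \<subseteq> {..<L}" "inj_on e {..<k}"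
      "resampling_limit_point k \<phi> f (\<lambda>j\<in>{..<k}. pt (e j))"
    have pt: "(\<lambda>j\<in>{..<k}. pt (restrict e {..<k} j)) = (\<lambda>j\<in>{..<k}. pt (e j))"
      by (intro restrict_ext) simp
    have "restrict e {..<k} \<in> E"
      unfolding E_def using e by (auto simp: inj_on_def cong: restrict_cong)
    from near[OF this] have "dist (f (moved L n (restrict e {..<k}))) (f (\<lambda>j\<in>{..<k}. pt (e j))) < \<epsilon>"
      by (simp only: pt)
    moreover have "moved L n (restrict e {..<k}) = (\<lambda>j\<in>{..<k}. \<phi> (n (e j)) (pt (e j)))"
      using e(1) by (auto simp: moved_def intro!: restrict_ext)
    ultimately show "dist (f (\<lambda>j\<in>{..<k}. \<phi> (n (e j)) (pt (e j)))) (f (\<lambda>j\<in>{..<k}. pt (e j))) < \<epsilon>"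
      by simp
  qed
qed

text \<open>Colour a \<open>k\<close>-set \<open>S\<close> by the function sending \<open>c\<close>
  in \<open>E\<close> to a net point near \<open>V S c\<close>. There are finitely many colours, and
  values sharing a net point are within \<open>\<epsilon>\<close>.\<close>

lemma Ramsey_compact:
  fixes V :: "nat set \<Rightarrow> 'c \<Rightarrow> 'b::metric_space"
  assumes K: "compact (UNIV :: 'b set)" and E: "finite E" and Z: "infinite Z" and "\<epsilon> > 0"
  obtains H where "H \<subseteq> Z" "infinite H"
    "\<And>S S' c. S \<subseteq> H \<Longrightarrow> finite S \<Longrightarrow> card S = k \<Longrightarrow> S' \<subseteq> H \<Longrightarrow> finite S' \<Longrightarrow> card S' = k \<Longrightarrow>
      c \<in> E \<Longrightarrow> dist (V S c) (V S' c) < \<epsilon>"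
proof -
  obtain T where T: "finite T" "(UNIV :: 'b set) \<subseteq> (\<Union>t\<in>T. ball t (\<epsilon>/2))"
    using K half_gt_zero[OF \<open>\<epsilon> > 0\<close>] unfolding compact_eq_totally_bounded by blast
  have "\<forall>b. \<exists>t\<in>T. dist t b < \<epsilon>/2"
    using T(2) by (auto simp: subset_eq)
  then obtain col where col: "\<And>b. col b \<in> T" "\<And>b. dist (col b) b < \<epsilon>/2"
    by metis
  have "finite (E \<rightarrow>\<^sub>E T)" using E T(1) by (intro finite_PiE) auto
  \<comment> \<open>Ramsey's theorem takes colours from an initial segment of the naturals, so the
    finite set of colour functions is numbered.\<close>
  then obtain enc s where enc: "enc ` (E \<rightarrow>\<^sub>E T) = {i. i < (s::nat)}" "inj_on enc (E \<rightarrow>\<^sub>E T)"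
    using finite_imp_inj_to_nat_seg by metis
  define C where "C S = (\<lambda>c\<in>E. col (V S c))" for S
  have C: "C S \<in> E \<rightarrow>\<^sub>E T" for S using col(1) by (auto simp: C_def)
  then have "\<forall>S. S \<subseteq> Z \<and> finite S \<and> card S = k \<longrightarrow> enc (C S) < s"
    using enc(1) by blast
  from Ramsey[OF Z this] obtain H t where H: "H \<subseteq> Z" "infinite H"
    "\<And>S. S \<subseteq> H \<Longrightarrow> finite S \<Longrightarrow> card S = k \<Longrightarrow> enc (C S) = t"
    by auto
  show thesis
  proof (rule that[OF H(1,2)])
    fix S S' c assume S: "S \<subseteq> H" "finite S" "card S = k" and S': "S' \<subseteq> H" "finite S'" "card S' = k"
      and c: "c \<in> E"
    have "enc (C S) = enc (C S')" using H(3)[OF S] H(3)[OF S'] by simp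
    then have "C S = C S'" by (rule inj_onD[OF enc(2) _ C C])
    then have eq: "col (V S c) = col (V S' c)" using c by (auto simp: C_def dest: fun_cong[of _ _ c])
    have "dist (col (V S c)) (V S' c) < \<epsilon> / 2"
      unfolding eq by (rule col(2))
    then show "dist (V S c) (V S' c) < \<epsilon>"
      by (rule dist_triangle_half_r[OF col(2)])
  qed
qed

section \<open>Sorting labels and passing to homogeneous levels\<close>

lemma sorted_enumeration_permutation:
  fixes a :: "nat \<Rightarrow> nat"
  assumes a: "inj_on a {..<k}"
  obtains \<pi> where "\<pi> permutes {..<k}" "\<And>j. j < k \<Longrightarrow> a (\<pi> j) = sorted_list_of_set (a ` {..<k}) ! j"
proof -
  let ?l = "sorted_list_of_set (a ` {..<k})"
  have len: "length ?l = k" using a by (simp add: card_image)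
  have set: "set ?l = a ` {..<k}" by simp
  have "bij_betw (\<lambda>j. ?l ! j) {..<k} (a ` {..<k})"
    using bij_betw_nth[of ?l "{..<k}" "a ` {..<k}"] len set by simp
  moreover have "bij_betw (the_inv_into {..<k} a) (a ` {..<k}) {..<k}"
    using a by (intro bij_betw_the_inv_into) (simp add: inj_on_imp_bij_betw)
  ultimately have "bij_betw (the_inv_into {..<k} a \<circ> (\<lambda>j. ?l ! j)) {..<k} {..<k}"
    by (rule bij_betw_trans)
  moreover define \<pi> where "\<pi> j = (if j < k then the_inv_into {..<k} a (?l ! j) else j)" for j
  ultimately have "bij_betw \<pi> {..<k} {..<k}"
    by (subst bij_betw_cong[of _ _ "the_inv_into {..<k} a \<circ> (\<lambda>j. ?l ! j)"]) (auto simp: \<pi>_def)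
  then have "\<pi> permutes {..<k}" by (rule bij_imp_permutes) (simp add: \<pi>_def)
  moreover have "a (\<pi> j) = ?l ! j" if "j < k" for j
  proof -
    have "?l ! j \<in> a ` {..<k}" using that len set nth_mem by metis
    then show ?thesis using that a by (simp add: \<pi>_def f_the_inv_into_f)
  qed
  ultimately show thesis by (rule that)
qed

text \<open>Division by \<open>R\<close> is monotone, so the sorted labels yield a sorted list of
  block numbers. Such a list is determined by its multiset, whichever labels inside the blocks were
  used.\<close>

lemma sorted_blocks_unique:
  fixes a a' :: "nat \<Rightarrow> nat"
  assumes a: "inj_on a {..<k}" "inj_on a' {..<k}" and R: "\<And>j. j < k \<Longrightarrow> a j div R = a' j div R"
  shows "map (\<lambda>i. i div R) (sorted_list_of_set (a ` {..<k})) = map (\<lambda>i. i div R) (sorted_list_of_set (a' ` {..<k}))"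
proof -
  have "mset (sorted_list_of_set A) = mset_set A" for A :: "nat set"
    by (metis mset_sorted_list_of_multiset sorted_list_of_mset_set)
  then have mset: "mset (map (\<lambda>i. i div R) (sorted_list_of_set (b ` {..<k}))) =
      image_mset (\<lambda>j. b j div R) (mset_set {..<k})" if "inj_on b {..<k}" for b :: "nat \<Rightarrow> nat"
    using that by (simp add: image_mset_mset_set[symmetric] multiset.map_comp comp_def)
  have sorted: "sorted (map (\<lambda>i. i div R) (sorted_list_of_set A))" for A
    by (intro sorted_map_mono[of "sorted_list_of_set A"] monoI) (auto intro: div_le_mono monotone_onI)
  have "image_mset (\<lambda>j. a j div R) (mset_set {..<k}) = image_mset (\<lambda>j. a' j div R) (mset_set {..<k})"
    using R by (intro image_mset_cong) auto
  then have "mset (map (\<lambda>i. i div R) (sorted_list_of_set (a ` {..<k}))) =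
      mset (map (\<lambda>i. i div R) (sorted_list_of_set (a' ` {..<k})))"
    using mset[OF a(1)] mset[OF a(2)] by simp
  then show ?thesis
    using sorted by (metis properties_for_sort sorted_sort_id)
qed

lemma sorted_list_of_set_strict_mono_image:
  fixes n :: "nat \<Rightarrow> nat"
  assumes n: "strict_mono_on A n" and A: "finite A"
  shows "sorted_list_of_set (n ` A) = map n (sorted_list_of_set A)"
proof (rule sorted_distinct_set_unique)
  have "mono_on A n" using n by (rule strict_mono_on_imp_mono_on)
  then show "sorted (map n (sorted_list_of_set A))"
    using A by (auto simp: sorted_iff_nth_mono_less mono_on_def) (metis nth_mem set_sorted_list_of_set sorted_sorted_list_of_set sorted_nth_mono less_imp_le length_sorted_list_of_set order_less_trans)
  show "distinct (map n (sorted_list_of_set A))"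
    using strict_mono_on_imp_inj_on[OF n] A by (simp add: distinct_map)
qed (use A in auto)

text \<open>Each point of \<^term>\<open>F\<close> gets a block of \<^term>\<open>R\<close> consecutive labels. By symmetry a value only
  depends on the set of levels used and on the points in the order of their levels, and as the levels
  increase with the labels this order depends only on the multiset of points. This leaves the
  dependence on the set of levels to Ramsey's theorem.\<close>

lemma homogeneous_selection:
  fixes f :: "(nat \<Rightarrow> 'a) \<Rightarrow> 'b::metric_space" and R :: nat
  assumes K: "compact (UNIV :: 'b set)" and \<phi>: "\<And>x. \<phi> 0 x = x"
    and sym: "\<And>v y \<pi>. inj_on v {..<k} \<Longrightarrow> \<forall>j<k. v j \<noteq> 0 \<Longrightarrow> \<pi> permutes {..<k} \<Longrightarrow>
      f (\<lambda>j\<in>{..<k}. \<phi> (v j) (y j)) = f (\<lambda>j\<in>{..<k}. \<phi> (v (\<pi> j)) (y (\<pi> j)))"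
    and F: "finite F" and "\<epsilon> > 0"
  obtains g n where "inj_on n (F \<times> {..<R})" "0 \<notin> n ` (F \<times> {..<R})"
    "\<And>x. x \<in> {..<k} \<rightarrow>\<^sub>E F \<Longrightarrow> resampling_limit_point k \<phi> f x \<Longrightarrow> g x = f x"
    "\<And>x i. x \<in> {..<k} \<rightarrow>\<^sub>E F \<Longrightarrow> i \<in> {..<k} \<rightarrow> {..<R} \<Longrightarrow> inj_on (\<lambda>j. (x j, i j)) {..<k} \<Longrightarrow>
      dist (g x) (f (\<lambda>j\<in>{..<k}. \<phi> (n (x j, i j)) (x j))) < \<epsilon>"
proof -
  obtain h where h: "bij_betw h {..<card F} F"
    using ex_bij_betw_nat_finite[OF F] by (auto simp: atLeast0LessThan)
  define idx where "idx = inv_into {..<card F} h"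
  have idx: "idx p < card F" "h (idx p) = p" if "p \<in> F" for p
    using that h bij_betw_inv_into[OF h] unfolding idx_def
    by (auto simp: bij_betw_def f_inv_into_f)
  \<comment> \<open>The point \<open>p\<close> owns the labels from \<open>idx p * R\<close> to
    \<open>idx p * R + R - 1\<close>, and division by \<open>R\<close> recovers the point from a
    label.\<close>
  define lab where "lab p i = idx p * R + i" for p i
  have lab_div: "lab p i div R = idx p" if "i < R" for p i
    using that by (simp add: lab_def)
  have lab_less: "lab p i < card F * R" if "p \<in> F" "i < R" for p i
  proof -
    have "lab p i < Suc (idx p) * R" using that by (simp add: lab_def)
    also have "\<dots> \<le> card F * R" using idx(1)[OF that(1)] by (intro mult_le_mono1) simp
    finally show ?thesis .
  qed
  have lab_inj: "p = q \<and> i = j" if "lab p i = lab q j" "p \<in> F" "q \<in> F" "i < R" "j < R" for p q i j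
  proof -
    have "idx p = idx q" using that lab_div by metis
    moreover from this have "i = j" using that(1) by (simp add: lab_def)
    ultimately show ?thesis using idx(2) that by metis
  qed
  \<comment> \<open>The value obtained when the levels in \<open>S\<close> are assigned in
    increasing order to the points numbered \<open>c 0\<close>, \<open>c 1\<close>, and so on.
    Taking \<open>H\<close> inside \<open>{1..}\<close> below excludes level 0, at which nothing is
    replaced.\<close>
  define V where "V S c = f (\<lambda>j\<in>{..<k}. \<phi> (sorted_list_of_set S ! j) (h (c j)))" for S c
  have E: "finite ({..<k} \<rightarrow>\<^sub>E {..<card F})" by (intro finite_PiE) auto
  obtain H where H: "H \<subseteq> {1..}" "infinite H"
    and hom: "\<And>S S' c. S \<subseteq> H \<Longrightarrow> finite S \<Longrightarrow> card S = k \<Longrightarrow> S' \<subseteq> H \<Longrightarrow> finite S' \<Longrightarrow> card S' = k \<Longrightarrow>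
      c \<in> {..<k} \<rightarrow>\<^sub>E {..<card F} \<Longrightarrow> dist (V S c) (V S' c) < \<epsilon>"
    using Ramsey_compact[OF K E infinite_Ici[of "1::nat"] \<open>\<epsilon> > 0\<close>, of k V] by metis
  \<comment> \<open>The points passed to \<open>choose_levels\<close> are constant on blocks. Only
    labels have to be distinct there, so tuples with repeated points are covered.\<close>
  obtain n where n: "strict_mono_on {..<card F * R} n" "n ` {..<card F * R} \<subseteq> H"
    and near: "\<And>e. e ` {..<k} \<subseteq> {..<card F * R} \<Longrightarrow> inj_on e {..<k} \<Longrightarrow>
      resampling_limit_point k \<phi> f (\<lambda>j\<in>{..<k}. h (e j div R)) \<Longrightarrow>
      dist (f (\<lambda>j\<in>{..<k}. \<phi> (n (e j)) (h (e j div R)))) (f (\<lambda>j\<in>{..<k}. h (e j div R))) < \<epsilon>"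
    by (rule choose_levels[where \<phi>=\<phi> and H=H and \<epsilon>=\<epsilon> and L="card F * R" and k=k and f=f and pt="\<lambda>l. h (l div R)", OF \<phi> H(2) \<open>\<epsilon> > 0\<close>], rule that)
  have n_pos: "n l \<noteq> 0" if "l < card F * R" for l
    using n(2) H(1) that by force
  have n_inj: "inj_on n {..<card F * R}" using n(1) by (rule strict_mono_on_imp_inj_on)
  define level where "level = (\<lambda>(p, i). n (lab p i))"
  define val where "val x i = f (\<lambda>j\<in>{..<k}. \<phi> (level (x j, i j)) (x j))" for x :: "nat \<Rightarrow> 'a" and i
  define valid where "valid x i \<longleftrightarrow> i \<in> {..<k} \<rightarrow> {..<R} \<and> inj_on (\<lambda>j. (x j, i j)) {..<k}" for x :: "nat \<Rightarrow> 'a" and i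
  have labels: "(\<lambda>j. lab (x j) (i j)) ` {..<k} \<subseteq> {..<card F * R}" "inj_on (\<lambda>j. lab (x j) (i j)) {..<k}"
    if "x \<in> {..<k} \<rightarrow>\<^sub>E F" "valid x i" for x i
  proof -
    have "x j \<in> F" "i j < R" if "j < k" for j
      using \<open>x \<in> {..<k} \<rightarrow>\<^sub>E F\<close> \<open>valid x i\<close> that by (auto simp: valid_def)
    then show "(\<lambda>j. lab (x j) (i j)) ` {..<k} \<subseteq> {..<card F * R}"
      using lab_less by auto
    show "inj_on (\<lambda>j. lab (x j) (i j)) {..<k}"
    proof (rule inj_onI)
      fix j j' assume j: "j \<in> {..<k}" "j' \<in> {..<k}" "lab (x j) (i j) = lab (x j') (i j')"
      then have "(x j, i j) = (x j', i j')"
        using lab_inj[OF j(3)] \<open>\<And>j. j < k \<Longrightarrow> x j \<in> F\<close> \<open>\<And>j. j < k \<Longrightarrow> i j < R\<close> by auto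
      then show "j = j'" using \<open>valid x i\<close> j by (auto simp: valid_def dest: inj_onD)
    qed
  qed
  have val_eq_V: "\<exists>S. S \<subseteq> H \<and> finite S \<and> card S = k \<and>
      val x i = V S (\<lambda>j\<in>{..<k}. map (\<lambda>l. l div R) (sorted_list_of_set ((\<lambda>j. lab (x j) (i j)) ` {..<k})) ! j)"
    if x: "x \<in> {..<k} \<rightarrow>\<^sub>E F" and i: "valid x i" for x i
  proof -
    define a where "a j = lab (x j) (i j)" for j
    have a: "a ` {..<k} \<subseteq> {..<card F * R}" "inj_on a {..<k}"
      using labels[OF x i] by (simp_all add: a_def[abs_def])
    have a_div: "h (a j div R) = x j" if "j < k" for j
      using that x i by (auto simp: a_def lab_div valid_def Pi_iff intro!: idx(2))
    obtain \<pi> where \<pi>: "\<pi> permutes {..<k}" "\<And>j. j < k \<Longrightarrow> a (\<pi> j) = sorted_list_of_set (a ` {..<k}) ! j"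
      using sorted_enumeration_permutation[OF a(2)] by metis
    have \<pi>_less: "\<pi> j < k" if "j < k" for j
      using permutes_in_image[OF \<pi>(1), of j] that by simp
    have len: "length (sorted_list_of_set (a ` {..<k})) = k"
      using a(2) by (simp add: card_image)
    have na: "inj_on (\<lambda>j. n (a j)) {..<k}"
      using comp_inj_on[OF a(2) inj_on_subset[OF n_inj a(1)]] by (simp add: comp_def)
    have "val x i = f (\<lambda>j\<in>{..<k}. \<phi> (n (a j)) (x j))"
      by (simp add: val_def level_def a_def)
    also have "\<dots> = f (\<lambda>j\<in>{..<k}. \<phi> (n (a (\<pi> j))) (x (\<pi> j)))"
      using a(1) n_pos by (intro sym na \<pi>(1)) auto
    also have "(\<lambda>j\<in>{..<k}. \<phi> (n (a (\<pi> j))) (x (\<pi> j))) = (\<lambda>j\<in>{..<k}. \<phi> (sorted_list_of_set (n ` a ` {..<k}) ! j)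
        (h ((\<lambda>j\<in>{..<k}. map (\<lambda>l. l div R) (sorted_list_of_set (a ` {..<k})) ! j) j)))"
    proof (rule restrict_ext)
      fix j assume "j \<in> {..<k}"
      then have j: "j < k" by simp
      have "sorted_list_of_set (n ` a ` {..<k}) = map n (sorted_list_of_set (a ` {..<k}))"
        using n(1) a(1) by (intro sorted_list_of_set_strict_mono_image) (auto simp: strict_mono_on_def)
      then have "sorted_list_of_set (n ` a ` {..<k}) ! j = n (a (\<pi> j))"
        using j len \<pi>(2)[OF j] by simp
      moreover have "h (map (\<lambda>l. l div R) (sorted_list_of_set (a ` {..<k})) ! j) = x (\<pi> j)"
        using j len a_div[OF \<pi>_less[OF j]] \<pi>(2)[OF j] by simp
      ultimately show "\<phi> (n (a (\<pi> j))) (x (\<pi> j)) = \<phi> (sorted_list_of_set (n ` a ` {..<k}) ! j)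
        (h ((\<lambda>j\<in>{..<k}. map (\<lambda>l. l div R) (sorted_list_of_set (a ` {..<k})) ! j) j))"
        using j by simp
    qed
    finally have "val x i = V (n ` a ` {..<k}) (\<lambda>j\<in>{..<k}. map (\<lambda>l. l div R) (sorted_list_of_set (a ` {..<k})) ! j)"
      unfolding V_def .
    moreover have "n ` a ` {..<k} \<subseteq> H" using a(1) n(2) by blast
    moreover have "card (n ` a ` {..<k}) = k" using card_image[OF na] by (simp add: image_image)
    ultimately show ?thesis by (intro exI[of _ "n ` a ` {..<k}"]) (simp add: a_def[abs_def])
  qed
  have val_close: "dist (val x i) (val x i') < \<epsilon>"
    if x: "x \<in> {..<k} \<rightarrow>\<^sub>E F" and i: "valid x i" and i': "valid x i'" for x i i'
  proof -
    define c where "c i = (\<lambda>j\<in>{..<k}. map (\<lambda>l. l div R) (sorted_list_of_set ((\<lambda>j. lab (x j) (i j)) ` {..<k})) ! j)" for i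
    have "c i = c i'"
    proof -
      have "lab (x j) (i j) div R = lab (x j) (i' j) div R" if "j < k" for j
        using that i i' by (auto simp: lab_div valid_def Pi_iff)
      from sorted_blocks_unique[OF labels(2)[OF x i] labels(2)[OF x i'] this]
      show ?thesis unfolding c_def by simp
    qed
    obtain S where S: "S \<subseteq> H" "finite S" "card S = k" "val x i = V S (c i)"
      using val_eq_V[OF x i] unfolding c_def by blast
    obtain S' where S': "S' \<subseteq> H" "finite S'" "card S' = k" "val x i' = V S' (c i')"
      using val_eq_V[OF x i'] unfolding c_def by blast
    have "c i \<in> {..<k} \<rightarrow>\<^sub>E {..<card F}"
    proof -
      let ?A = "(\<lambda>j. lab (x j) (i j)) ` {..<k}"
      have len: "length (sorted_list_of_set ?A) = k"
        using labels(2)[OF x i] by (simp add: card_image)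
      have "map (\<lambda>l. l div R) (sorted_list_of_set ?A) ! j < card F" if "j < k" for j
      proof -
        have "sorted_list_of_set ?A ! j \<in> ?A"
          using nth_mem[of j "sorted_list_of_set ?A"] that len by simp
        then have "sorted_list_of_set ?A ! j < card F * R" using labels(1)[OF x i] by blast
        then show ?thesis using that len by (simp add: less_mult_imp_div_less)
      qed
      then show ?thesis by (auto simp: c_def)
    qed
    from hom[OF S(1-3) S'(1-3) this] show ?thesis
      using S(4) S'(4) \<open>c i = c i'\<close> by simp
  qed
  have val_near: "dist (val x i) (f x) < \<epsilon>"
    if x: "x \<in> {..<k} \<rightarrow>\<^sub>E F" and i: "valid x i" and G: "resampling_limit_point k \<phi> f x" for x i
  proof -
    have hx: "h (lab (x j) (i j) div R) = x j" if "j < k" for j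
      using that x i by (auto simp: lab_div valid_def Pi_iff intro!: idx(2))
    then have "(\<lambda>j\<in>{..<k}. h (lab (x j) (i j) div R)) = x"
      using x by (auto simp: PiE_iff extensional_def)
    moreover have "(\<lambda>j\<in>{..<k}. \<phi> (n (lab (x j) (i j))) (h (lab (x j) (i j) div R))) =
        (\<lambda>j\<in>{..<k}. \<phi> (level (x j, i j)) (x j))"
      using hx by (auto simp: level_def)
    ultimately show ?thesis
      using near[OF labels[OF x i]] G by (simp add: val_def)
  qed
  \<comment> \<open>On good tuples the value is prescribed. Elsewhere any admissible choice of
    levels will do, because \<open>val_close\<close> shows that admissible choices differ by less
    than \<open>\<epsilon>\<close>.\<close>
  define g where "g x = (if resampling_limit_point k \<phi> f x then f x else val x (SOME i. valid x i))" for x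
  show thesis
  proof (rule that)
    show "inj_on level (F \<times> {..<R})"
      using lab_inj lab_less by (auto simp: level_def intro!: inj_onI dest!: inj_onD[OF n_inj])
    show "0 \<notin> level ` (F \<times> {..<R})"
      using n_pos lab_less by (fastforce simp: level_def)
    show "g x = f x" if "resampling_limit_point k \<phi> f x" for x
      using that by (simp add: g_def)
    fix x i assume x: "x \<in> {..<k} \<rightarrow>\<^sub>E F"
      and i: "i \<in> {..<k} \<rightarrow> {..<R}" "inj_on (\<lambda>j. (x j, i j)) {..<k}"
    then have valid: "valid x i" by (simp add: valid_def)
    then have "valid x (SOME i. valid x i)"
      using someI[of "\<lambda>i. valid x i" i] by simp
    then have "dist (val x (SOME i. valid x i)) (val x i) < \<epsilon>"
      by (rule val_close[OF x _ valid])
    moreover have "dist (f x) (val x i) < \<epsilon>" if "resampling_limit_point k \<phi> f x"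
      using val_near[OF x valid that] by (simp only: dist_commute)
    ultimately have "dist (g x) (val x i) < \<epsilon>"
      by (simp add: g_def)
    then show "dist (g x) (f (\<lambda>j\<in>{..<k}. \<phi> (level (x j, i j)) (x j))) < \<epsilon>"
      by (simp add: val_def)
  qed
qed

section \<open>Functions satisfying the constraint everywhere\<close>

text \<open>Finitely many index tuples involve only finitely many positions of \<open>y\<close>.
  Hence, as \<open>M\<close> is closed, it suffices to match each initial segment of
  \<open>y\<close> with some \<open>z\<close> satisfying the constraint.\<close>

lemma tilde_approx_mem:
  fixes f g :: "(nat \<Rightarrow> 'a) \<Rightarrow> 'b::metric_space"
  assumes M: "closedin (product_topology (\<lambda>_. euclidean) (distinct_tuples k)) M"
    and approx: "\<And>m r. \<exists>z. tilde k f z \<in> M \<and> (\<forall>I\<in>distinct_tuples k. I ` {..<k} \<subseteq> {..<m} \<longrightarrow>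
      dist (g (\<lambda>j\<in>{..<k}. y (I j))) (f (\<lambda>j\<in>{..<k}. z (I j))) < 1 / Suc r)"
  shows "tilde k g y \<in> M"
proof (rule closedin_product_approx[OF M])
  show "tilde k g y \<in> extensional (distinct_tuples k)"
    by (simp add: tilde_def)
  fix J r assume J: "finite J" "J \<subseteq> distinct_tuples k"
  have "finite (\<Union>I\<in>J. I ` {..<k})" using J(1) by auto
  then obtain m where m: "(\<Union>I\<in>J. I ` {..<k}) \<subseteq> {..<m}"
    using finite_nat_bounded by blast
  obtain z where z: "tilde k f z \<in> M" "\<And>I. I \<in> distinct_tuples k \<Longrightarrow> I ` {..<k} \<subseteq> {..<m} \<Longrightarrow>
      dist (g (\<lambda>j\<in>{..<k}. y (I j))) (f (\<lambda>j\<in>{..<k}. z (I j))) < 1 / Suc r"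
    using approx[of m r] by blast
  have "dist (tilde k g y I) (tilde k f z I) < 1 / Suc r" if "I \<in> J" for I
  proof -
    have "I \<in> distinct_tuples k" "I ` {..<k} \<subseteq> {..<m}" using that J(2) m by auto
    from z(2)[OF this] this(1) show ?thesis by (simp add: tilde_def)
  qed
  then show "\<exists>z'\<in>M. \<forall>I\<in>J. dist (tilde k g y I) (z' I) < 1 / Suc r"
    using z(1) by blast
qed

text \<open>The set \<open>C F r\<close> collects functions that, on injective tuples from
  \<open>F\<close>, evaluate \<open>f\<close> at samples with one level per point, the levels being
  distinct. For an injective sequence these samples extend to some \<open>z\<close> with
  \<open>tilde k f z\<close> in \<open>M\<close>, and a cluster point inherits the
  constraint.\<close>

lemma everywhere_modification:
  fixes f :: "(nat \<Rightarrow> 'a) \<Rightarrow> 'b::metric_space"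
  assumes K: "compact (UNIV :: 'b set)" and \<phi>: "\<And>x. \<phi> 0 x = x"
    and M: "closedin (product_topology (\<lambda>_. euclidean) (distinct_tuples k)) M"
    and sample: "\<forall>m (n :: nat \<Rightarrow> nat) y. inj_on n {..<m} \<longrightarrow> (\<forall>i<m. n i \<noteq> 0) \<longrightarrow>
      (\<exists>z. tilde k f z \<in> M \<and> (\<forall>i<m. z i = \<phi> (n i) (y i)))"
  obtains g where "\<And>x. x \<in> extensional {..<k} \<Longrightarrow> resampling_limit_point k \<phi> f x \<Longrightarrow> g x = f x"
    "\<And>y. inj y \<Longrightarrow> tilde k g y \<in> M"
proof -
  define C where "C F r = {g. \<exists>n. inj_on n F \<and> 0 \<notin> n ` F \<and> (\<forall>x\<in>{..<k} \<rightarrow>\<^sub>E F. inj_on x {..<k} \<longrightarrow>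
      g x = f (\<lambda>j\<in>{..<k}. \<phi> (n (x j)) (x j)) \<and>
      (resampling_limit_point k \<phi> f x \<longrightarrow> dist (g x) (f x) < 1 / Suc r))}" for F :: "'a set" and r
  have ne: "C F r \<noteq> {}" if F: "finite F" for F r
  proof -
    obtain h where h: "bij_betw h {..<card F} F"
      using ex_bij_betw_nat_finite[OF F] by (auto simp: atLeast0LessThan)
    define idx where "idx = inv_into {..<card F} h"
    have idx: "idx p < card F" "h (idx p) = p" if "p \<in> F" for p
      using that h bij_betw_inv_into[OF h] unfolding idx_def
      by (auto simp: bij_betw_def f_inv_into_f)
    have pos: "1 / real (Suc r) > 0" by simp
    obtain n where n: "strict_mono_on {..<card F} n" "n ` {..<card F} \<subseteq> {1..}"
      and near: "\<And>e. e ` {..<k} \<subseteq> {..<card F} \<Longrightarrow> inj_on e {..<k} \<Longrightarrow>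
        resampling_limit_point k \<phi> f (\<lambda>j\<in>{..<k}. h (e j)) \<Longrightarrow>
        dist (f (\<lambda>j\<in>{..<k}. \<phi> (n (e j)) (h (e j)))) (f (\<lambda>j\<in>{..<k}. h (e j))) < 1 / Suc r"
      by (rule choose_levels[where \<phi>=\<phi> and H="{1..}" and \<epsilon>="1 / Suc r" and L="card F" and k=k and f=f and pt=h, OF \<phi> infinite_Ici pos], rule that)
    have idx_inj: "inj_on idx F" using idx(2) by (metis inj_onI)
    define level where "level p = n (idx p)" for p
    have "inj_on n {..<card F}" using n(1) by (rule strict_mono_on_imp_inj_on)
    then have "inj_on level F"
      using idx_inj idx(1) by (auto simp: level_def inj_on_def)
    moreover have "0 \<notin> level ` F"
      using n(2) idx(1) by (fastforce simp: level_def)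
    moreover have "dist (f (\<lambda>j\<in>{..<k}. \<phi> (level (x j)) (x j))) (f x) < 1 / Suc r"
      if x: "x \<in> {..<k} \<rightarrow>\<^sub>E F" "inj_on x {..<k}" "resampling_limit_point k \<phi> f x" for x
    proof -
      have xF: "x j \<in> F" if "j < k" for j using x(1) that by auto
      have 1: "(\<lambda>j\<in>{..<k}. h (idx (x j))) = x"
        using x(1) idx(2) xF by (auto simp: PiE_iff extensional_def)
      have 2: "(\<lambda>j\<in>{..<k}. \<phi> (n (idx (x j))) (h (idx (x j)))) = (\<lambda>j\<in>{..<k}. \<phi> (level (x j)) (x j))"
        using idx(2) xF by (auto simp: level_def)
      have "inj_on (\<lambda>j. idx (x j)) {..<k}"
        using x(2) idx_inj xF by (auto simp: inj_on_def)
      moreover have "(\<lambda>j. idx (x j)) ` {..<k} \<subseteq> {..<card F}"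
        using idx(1) xF by auto
      ultimately show ?thesis using near[of "\<lambda>j. idx (x j)"] x(3) by (simp only: 1 2)
    qed
    ultimately have "(\<lambda>x. f (\<lambda>j\<in>{..<k}. \<phi> (level (x j)) (x j))) \<in> C F r"
      unfolding C_def by blast
    then show ?thesis by blast
  qed
  have anti: "C F' r' \<subseteq> C F r" if "F \<subseteq> F'" "r \<le> r'" for F F' r r'
  proof
    fix g assume "g \<in> C F' r'"
    then obtain n where n: "inj_on n F'" "0 \<notin> n ` F'"
      and g: "\<And>x. x \<in> {..<k} \<rightarrow>\<^sub>E F' \<Longrightarrow> inj_on x {..<k} \<Longrightarrow>
        g x = f (\<lambda>j\<in>{..<k}. \<phi> (n (x j)) (x j)) \<and>
        (resampling_limit_point k \<phi> f x \<longrightarrow> dist (g x) (f x) < 1 / Suc r')"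
      unfolding C_def by blast
    have "1 / real (Suc r') \<le> 1 / Suc r" using that(2) by (intro divide_left_mono) auto
    moreover have "{..<k} \<rightarrow>\<^sub>E F \<subseteq> {..<k} \<rightarrow>\<^sub>E F'" using that(1) by (intro PiE_mono) auto
    moreover have "inj_on n F" "0 \<notin> n ` F" using n that(1) by (auto intro: inj_on_subset)
    ultimately show "g \<in> C F r"
      unfolding C_def using g by (intro CollectI exI[of _ n]) (meson less_le_trans subsetD)
  qed
  obtain g where g: "\<And>F r T. finite F \<Longrightarrow> finite T \<Longrightarrow> \<exists>g'\<in>C F r. \<forall>t\<in>T. dist (g t) (g' t) < 1 / Suc r"
    by (rule compact_cluster_function[of C, OF K ne anti], assumption, assumption, assumption, rule that)
  have g_eq: "g x = f x" if x: "x \<in> extensional {..<k}" "inj_on x {..<k}" "resampling_limit_point k \<phi> f x" for x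
  proof (rule eq_of_dist_less_inverse_Suc)
    fix r :: nat
    obtain g' where g': "g' \<in> C (x ` {..<k}) r" "dist (g x) (g' x) < 1 / Suc r"
      using g[of "x ` {..<k}" "{x}" r] by auto
    have "x \<in> {..<k} \<rightarrow>\<^sub>E x ` {..<k}" using x(1) by (auto simp: PiE_def)
    then have "dist (g' x) (f x) < 1 / Suc r" using g'(1) x(2,3) unfolding C_def by blast
    then show "dist (g x) (f x) < 2 / Suc r"
      using g'(2) dist_triangle[of "g x" "f x" "g' x"] by simp
  qed
  \<comment> \<open>The sets \<open>C F r\<close> control injective tuples only. The other tuples
    keep the value of \<open>f\<close>; they do not occur in \<open>tilde\<close> of an injective
    sequence.\<close>
  define g1 where "g1 x = (if inj_on x {..<k} then g x else f x)" for x
  show thesis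
  proof (rule that)
    show "g1 x = f x" if "x \<in> extensional {..<k}" "resampling_limit_point k \<phi> f x" for x
      using g_eq that by (simp add: g1_def)
    fix y :: "nat \<Rightarrow> 'a" assume y: "inj y"
    show "tilde k g1 y \<in> M"
    proof (rule tilde_approx_mem[OF M])
      fix m r :: nat
      let ?T = "(\<lambda>I. \<lambda>j\<in>{..<k}. y (I j)) ` ({..<k} \<rightarrow>\<^sub>E {..<m})"
      have "finite ?T" by (simp add: finite_PiE)
      then obtain g' where g': "g' \<in> C (y ` {..<m}) r" "\<And>t. t \<in> ?T \<Longrightarrow> dist (g t) (g' t) < 1 / Suc r"
        using g[of "y ` {..<m}" ?T r] by blast
      from g'(1) obtain n where n: "inj_on n (y ` {..<m})" "0 \<notin> n ` y ` {..<m}"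
        and "\<forall>x\<in>{..<k} \<rightarrow>\<^sub>E y ` {..<m}. inj_on x {..<k} \<longrightarrow>
          g' x = f (\<lambda>j\<in>{..<k}. \<phi> (n (x j)) (x j)) \<and>
          (resampling_limit_point k \<phi> f x \<longrightarrow> dist (g' x) (f x) < 1 / Suc r)"
        unfolding C_def mem_Collect_eq by (elim exE conjE)
      then have g'_eq: "g' x = f (\<lambda>j\<in>{..<k}. \<phi> (n (x j)) (x j))"
        if "x \<in> {..<k} \<rightarrow>\<^sub>E y ` {..<m}" "inj_on x {..<k}" for x
        using that by blast
      have "inj_on (\<lambda>i. n (y i)) {..<m}"
        using n(1) y by (auto simp: inj_on_def inj_def)
      moreover have "n (y i) \<noteq> 0" if "i < m" for i using n(2) that by force
      ultimately obtain z where z: "tilde k f z \<in> M" "\<And>i. i < m \<Longrightarrow> z i = \<phi> (n (y i)) (y i)"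
        using spec[OF spec[OF spec[OF sample, of m], of "\<lambda>i. n (y i)"], of y] by blast
      show "\<exists>z. tilde k f z \<in> M \<and> (\<forall>I\<in>distinct_tuples k. I ` {..<k} \<subseteq> {..<m} \<longrightarrow>
        dist (g1 (\<lambda>j\<in>{..<k}. y (I j))) (f (\<lambda>j\<in>{..<k}. z (I j))) < 1 / Suc r)"
      proof (intro exI[of _ z] conjI z ballI impI)
        fix I assume I: "I \<in> distinct_tuples k" "I ` {..<k} \<subseteq> {..<m}"
        let ?x = "\<lambda>j\<in>{..<k}. y (I j)"
        have I_inj: "inj_on I {..<k}" and "I \<in> {..<k} \<rightarrow>\<^sub>E {..<m}"
          using I by (auto simp: distinct_tuples_def PiE_iff)
        then have "?x \<in> ?T" by blast
        then have "dist (g ?x) (g' ?x) < 1 / Suc r" by (rule g'(2))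
        moreover have x_inj: "inj_on ?x {..<k}"
          using I_inj y by (auto simp: inj_on_def inj_def)
        moreover have "g' ?x = f (\<lambda>j\<in>{..<k}. \<phi> (n (?x j)) (?x j))"
          using I(2) by (intro g'_eq x_inj) auto
        moreover have "(\<lambda>j\<in>{..<k}. \<phi> (n (?x j)) (?x j)) = (\<lambda>j\<in>{..<k}. z (I j))"
          using I(2) by (intro restrict_ext) (auto simp: z(2) image_subset_iff)
        ultimately show "dist (g1 ?x) (f (\<lambda>j\<in>{..<k}. z (I j))) < 1 / Suc r"
          by (simp add: g1_def)
      qed
    qed
  qed
qed

text \<open>Repeated points need different levels, so each point now carries \<open>Suc r\<close>
  levels and the approximating functions must be nearly independent of which ones are used. Symmetry
  of \<open>f\<close> is exact on sample tuples with distinct levels and passes to the cluster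
  point.\<close>

lemma symmetric_everywhere_modification:
  fixes f :: "(nat \<Rightarrow> 'a) \<Rightarrow> 'b::metric_space"
  assumes K: "compact (UNIV :: 'b set)" and \<phi>: "\<And>x. \<phi> 0 x = x"
    and M: "closedin (product_topology (\<lambda>_. euclidean) (distinct_tuples k)) M"
    and sample: "\<forall>m (n :: nat \<Rightarrow> nat) y. inj_on n {..<m} \<longrightarrow> (\<forall>i<m. n i \<noteq> 0) \<longrightarrow>
      (\<exists>z. (tilde k f z \<in> M \<and> (\<forall>\<pi>. \<pi> permutes {..<k} \<longrightarrow>
        f (\<lambda>j\<in>{..<k}. z j) = f (\<lambda>j\<in>{..<k}. z (\<pi> j)))) \<and> (\<forall>i<m. z i = \<phi> (n i) (y i)))"
  obtains g where "\<And>x. x \<in> extensional {..<k} \<Longrightarrow> resampling_limit_point k \<phi> f x \<Longrightarrow> g x = f x"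
    "\<And>x \<pi>. x \<in> extensional {..<k} \<Longrightarrow> \<pi> permutes {..<k} \<Longrightarrow> g x = g (\<lambda>j\<in>{..<k}. x (\<pi> j))"
    "\<And>y. tilde k g y \<in> M"
proof -
  have sym: "f (\<lambda>j\<in>{..<k}. \<phi> (v j) (y j)) = f (\<lambda>j\<in>{..<k}. \<phi> (v (\<pi> j)) (y (\<pi> j)))"
    if v: "inj_on v {..<k}" "\<forall>j<k. v j \<noteq> 0" and \<pi>: "\<pi> permutes {..<k}" for v y \<pi>
  proof -
    obtain z where z: "f (\<lambda>j\<in>{..<k}. z j) = f (\<lambda>j\<in>{..<k}. z (\<pi> j))" "\<And>j. j < k \<Longrightarrow> z j = \<phi> (v j) (y j)"
      using spec[OF spec[OF spec[OF sample, of k], of v], of y] v \<pi> by blast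
    have "(\<lambda>j\<in>{..<k}. z j) = (\<lambda>j\<in>{..<k}. \<phi> (v j) (y j))"
      using z(2) by (intro restrict_ext) auto
    moreover have "(\<lambda>j\<in>{..<k}. z (\<pi> j)) = (\<lambda>j\<in>{..<k}. \<phi> (v (\<pi> j)) (y (\<pi> j)))"
      using z(2) permutes_in_image[OF \<pi>] by (intro restrict_ext) auto
    ultimately show ?thesis using z(1) by simp
  qed
  \<comment> \<open>A tuple may repeat points as long as repetitions use different level numbers
    \<open>i j\<close>. The requirement is vacuous for tuples with more repetitions of a point than
    there are levels, and takes effect as \<open>r\<close> grows.\<close>
  define C where "C F r = {g. \<exists>n. inj_on n (F \<times> {..<Suc r}) \<and> 0 \<notin> n ` (F \<times> {..<Suc r}) \<and>
      (\<forall>x\<in>{..<k} \<rightarrow>\<^sub>E F. (resampling_limit_point k \<phi> f x \<longrightarrow> g x = f x) \<and>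
        (\<forall>i\<in>{..<k} \<rightarrow> {..<Suc r}. inj_on (\<lambda>j. (x j, i j)) {..<k} \<longrightarrow>
          dist (g x) (f (\<lambda>j\<in>{..<k}. \<phi> (n (x j, i j)) (x j))) < 1 / Suc r))}" for F :: "'a set" and r
  have CE: thesis if "g \<in> C F r" and "\<And>n. inj_on n (F \<times> {..<Suc r}) \<Longrightarrow> 0 \<notin> n ` (F \<times> {..<Suc r}) \<Longrightarrow>
      (\<And>x. x \<in> {..<k} \<rightarrow>\<^sub>E F \<Longrightarrow> resampling_limit_point k \<phi> f x \<Longrightarrow> g x = f x) \<Longrightarrow>
      (\<And>x i. x \<in> {..<k} \<rightarrow>\<^sub>E F \<Longrightarrow> i \<in> {..<k} \<rightarrow> {..<Suc r} \<Longrightarrow> inj_on (\<lambda>j. (x j, i j)) {..<k} \<Longrightarrow>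
        dist (g x) (f (\<lambda>j\<in>{..<k}. \<phi> (n (x j, i j)) (x j))) < 1 / Suc r) \<Longrightarrow> thesis" for g F r thesis
  proof -
    from that(1) obtain n where n: "inj_on n (F \<times> {..<Suc r})" "0 \<notin> n ` (F \<times> {..<Suc r})"
      "\<forall>x\<in>{..<k} \<rightarrow>\<^sub>E F. (resampling_limit_point k \<phi> f x \<longrightarrow> g x = f x) \<and>
        (\<forall>i\<in>{..<k} \<rightarrow> {..<Suc r}. inj_on (\<lambda>j. (x j, i j)) {..<k} \<longrightarrow>
          dist (g x) (f (\<lambda>j\<in>{..<k}. \<phi> (n (x j, i j)) (x j))) < 1 / Suc r)"
      unfolding C_def mem_Collect_eq by (elim exE conjE)
    show thesis
      by (rule that(2)[OF n(1,2)]) (use n(3) in \<open>blast+\<close>)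
  qed
  have ne: "C F r \<noteq> {}" if F: "finite F" for F r
  proof -
    have pos: "1 / real (Suc r) > 0" by simp
    obtain g n where "inj_on n (F \<times> {..<Suc r})" "0 \<notin> n ` (F \<times> {..<Suc r})"
      "\<And>x. x \<in> {..<k} \<rightarrow>\<^sub>E F \<Longrightarrow> resampling_limit_point k \<phi> f x \<Longrightarrow> g x = f x"
      "\<And>x i. x \<in> {..<k} \<rightarrow>\<^sub>E F \<Longrightarrow> i \<in> {..<k} \<rightarrow> {..<Suc r} \<Longrightarrow> inj_on (\<lambda>j. (x j, i j)) {..<k} \<Longrightarrow>
        dist (g x) (f (\<lambda>j\<in>{..<k}. \<phi> (n (x j, i j)) (x j))) < 1 / Suc r"
      by (rule homogeneous_selection[where \<phi>=\<phi> and f=f and k=k and F=F and \<epsilon>="1 / Suc r" and R="Suc r",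
            OF K \<phi> sym F pos], assumption, assumption, assumption, rule that)
    then have "g \<in> C F r"
      unfolding C_def by (intro CollectI exI[of _ n] conjI ballI impI)
    then show ?thesis by blast
  qed
  have anti: "C F' r' \<subseteq> C F r" if "F \<subseteq> F'" "r \<le> r'" for F F' r r'
  proof
    fix g assume "g \<in> C F' r'"
    then show "g \<in> C F r"
    proof (rule CE)
      fix n assume n: "inj_on n (F' \<times> {..<Suc r'})" "0 \<notin> n ` (F' \<times> {..<Suc r'})"
        and g: "\<And>x. x \<in> {..<k} \<rightarrow>\<^sub>E F' \<Longrightarrow> resampling_limit_point k \<phi> f x \<Longrightarrow> g x = f x"
        and close: "\<And>x i. x \<in> {..<k} \<rightarrow>\<^sub>E F' \<Longrightarrow> i \<in> {..<k} \<rightarrow> {..<Suc r'} \<Longrightarrow> inj_on (\<lambda>j. (x j, i j)) {..<k} \<Longrightarrow>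
          dist (g x) (f (\<lambda>j\<in>{..<k}. \<phi> (n (x j, i j)) (x j))) < 1 / Suc r'"
      have sub: "F \<times> {..<Suc r} \<subseteq> F' \<times> {..<Suc r'}" using that by auto
      have xF: "x \<in> {..<k} \<rightarrow>\<^sub>E F'" if "x \<in> {..<k} \<rightarrow>\<^sub>E F" for x
        using that \<open>F \<subseteq> F'\<close> PiE_mono[of "{..<k}" "\<lambda>_. F" "\<lambda>_. F'"] by blast
      have iF: "i \<in> {..<k} \<rightarrow> {..<Suc r'}" if "i \<in> {..<k} \<rightarrow> {..<Suc r}" for i :: "nat \<Rightarrow> nat"
      proof (rule Pi_I)
        fix j assume "j \<in> {..<k}"
        then have "i j < Suc r" using that by auto
        then show "i j \<in> {..<Suc r'}" using \<open>r \<le> r'\<close> by simp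
      qed
      have le: "1 / real (Suc r') \<le> 1 / Suc r" using that(2) by (intro divide_left_mono) auto
      show "g \<in> C F r"
        unfolding C_def
        by (intro CollectI exI[of _ n] conjI ballI impI g xF less_le_trans[OF close le] iF
            inj_on_subset[OF n(1) sub]) (use n(2) sub in \<open>blast+\<close>)
    qed
  qed
  obtain g where g: "\<And>F r T. finite F \<Longrightarrow> finite T \<Longrightarrow> \<exists>g'\<in>C F r. \<forall>t\<in>T. dist (g t) (g' t) < 1 / Suc r"
    by (rule compact_cluster_function[of C, OF K ne anti], assumption, assumption, assumption, rule that)
  show thesis
  proof (rule that)
    fix x :: "nat \<Rightarrow> 'a" assume x: "x \<in> extensional {..<k}"
    then have xF: "x \<in> {..<k} \<rightarrow>\<^sub>E x ` {..<k}" by (auto simp: PiE_def)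
    show "g x = f x" if good: "resampling_limit_point k \<phi> f x"
    proof (rule eq_of_dist_less_inverse_Suc)
      fix r :: nat
      obtain g' where g': "g' \<in> C (x ` {..<k}) r" "dist (g x) (g' x) < 1 / Suc r"
        using g[of "x ` {..<k}" "{x}" r] by auto
      have "g' x = f x" using g'(1) by (rule CE) (use xF good in blast)
      then show "dist (g x) (f x) < 1 / Suc r" using g'(2) by simp
    qed
    show "g x = g (\<lambda>j\<in>{..<k}. x (\<pi> j))" if \<pi>: "\<pi> permutes {..<k}" for \<pi>
    proof (rule eq_of_dist_less_inverse_Suc)
      \<comment> \<open>For \<open>r \<ge> k\<close> the coordinate number \<open>j\<close> can
        itself serve as level number. The permuted tuple uses level number \<open>\<pi> j\<close>,
        so both tuples lead to the same samples in a different order.\<close>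
      fix r :: nat assume r: "r \<ge> k"
      let ?x = "\<lambda>j\<in>{..<k}. x (\<pi> j)"
      have \<pi>_less: "\<pi> j < k" if "j < k" for j
        using permutes_in_image[OF \<pi>, of j] that by simp
      obtain g' where g': "g' \<in> C (x ` {..<k}) r" "dist (g x) (g' x) < 1 / Suc r" "dist (g ?x) (g' ?x) < 1 / Suc r"
        using g[of "x ` {..<k}" "{x, ?x}" r] by auto
      from g'(1) have "dist (g' x) (g' ?x) < 2 / Suc r"
      proof (rule CE)
        fix n assume n: "inj_on n (x ` {..<k} \<times> {..<Suc r})" "0 \<notin> n ` (x ` {..<k} \<times> {..<Suc r})"
          and close: "\<And>u i. u \<in> {..<k} \<rightarrow>\<^sub>E x ` {..<k} \<Longrightarrow> i \<in> {..<k} \<rightarrow> {..<Suc r} \<Longrightarrow> inj_on (\<lambda>j. (u j, i j)) {..<k} \<Longrightarrow>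
            dist (g' u) (f (\<lambda>j\<in>{..<k}. \<phi> (n (u j, i j)) (u j))) < 1 / Suc r"
        define v where "v j = n (x j, j)" for j
        have "inj_on v {..<k}"
          unfolding v_def using r by (intro inj_onI) (auto dest!: inj_onD[OF n(1)])
        moreover have "\<forall>j<k. v j \<noteq> 0"
        proof (intro allI impI)
          fix j assume "j < k"
          then have "(x j, j) \<in> x ` {..<k} \<times> {..<Suc r}" using r by auto
          then show "v j \<noteq> 0" using n(2) unfolding v_def by (metis imageI)
        qed
        ultimately have eq: "f (\<lambda>j\<in>{..<k}. \<phi> (v j) (x j)) = f (\<lambda>j\<in>{..<k}. \<phi> (v (\<pi> j)) (x (\<pi> j)))"
          using \<pi> by (rule sym)
        have 1: "dist (g' x) (f (\<lambda>j\<in>{..<k}. \<phi> (v j) (x j))) < 1 / Suc r"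
          unfolding v_def using r by (intro close xF) (auto simp: inj_on_def)
        have "dist (g' ?x) (f (\<lambda>j\<in>{..<k}. \<phi> (n (?x j, \<pi> j)) (?x j))) < 1 / Suc r"
        proof (rule close)
          show "?x \<in> {..<k} \<rightarrow>\<^sub>E x ` {..<k}" using \<pi>_less by auto
          show "\<pi> \<in> {..<k} \<rightarrow> {..<Suc r}" using \<pi>_less r by fastforce
          show "inj_on (\<lambda>j. (?x j, \<pi> j)) {..<k}"
            using permutes_inj[OF \<pi>] by (auto simp: inj_on_def inj_def)
        qed
        moreover have "(\<lambda>j\<in>{..<k}. \<phi> (n (?x j, \<pi> j)) (?x j)) = (\<lambda>j\<in>{..<k}. \<phi> (v (\<pi> j)) (x (\<pi> j)))"
          by (intro restrict_ext) (simp add: v_def)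
        ultimately have 2: "dist (g' ?x) (f (\<lambda>j\<in>{..<k}. \<phi> (v j) (x j))) < 1 / Suc r"
          using eq by simp
        show ?thesis
          using 1 2 dist_triangle2[of "g' x" "g' ?x" "f (\<lambda>j\<in>{..<k}. \<phi> (v j) (x j))"] by simp
      qed
      moreover have "dist (g x) (g ?x) \<le> dist (g x) (g' x) + dist (g' x) (g' ?x) + dist (g ?x) (g' ?x)"
        using dist_triangle[of "g x" "g ?x" "g' x"] dist_triangle[of "g' x" "g ?x" "g' ?x"]
        by (simp add: dist_commute)
      ultimately show "dist (g x) (g ?x) < 4 / Suc r"
        using g'(2,3) by simp
    qed
  next
    fix y :: "nat \<Rightarrow> 'a"
    show "tilde k g y \<in> M"
    proof (rule tilde_approx_mem[OF M])
      fix m r0 :: nat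
      \<comment> \<open>With \<open>m \<le> r\<close> position \<open>i\<close> can use level number
        \<open>i\<close>, which separates equal terms of \<open>y\<close>; with
        \<open>2 * r0 + 1 \<le> r\<close> the two errors of size \<open>1 / Suc r\<close> add up to
        at most \<open>1 / Suc r0\<close>.\<close>
      define r where "r = max (2 * r0 + 1) m"
      have r: "m \<le> r" "2 / Suc r \<le> 1 / Suc r0" by (auto simp: r_def field_simps)
      let ?T = "(\<lambda>I. \<lambda>j\<in>{..<k}. y (I j)) ` ({..<k} \<rightarrow>\<^sub>E {..<m})"
      have "finite ?T" by (simp add: finite_PiE)
      then obtain g' where g': "g' \<in> C (y ` {..<m}) r" "\<And>t. t \<in> ?T \<Longrightarrow> dist (g t) (g' t) < 1 / Suc r"
        using g[of "y ` {..<m}" ?T r] by blast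
      from g'(1) show "\<exists>z. tilde k f z \<in> M \<and> (\<forall>I\<in>distinct_tuples k. I ` {..<k} \<subseteq> {..<m} \<longrightarrow>
        dist (g (\<lambda>j\<in>{..<k}. y (I j))) (f (\<lambda>j\<in>{..<k}. z (I j))) < 1 / Suc r0)"
      proof (rule CE)
        fix n assume n: "inj_on n (y ` {..<m} \<times> {..<Suc r})" "0 \<notin> n ` (y ` {..<m} \<times> {..<Suc r})"
          and close: "\<And>u i. u \<in> {..<k} \<rightarrow>\<^sub>E y ` {..<m} \<Longrightarrow> i \<in> {..<k} \<rightarrow> {..<Suc r} \<Longrightarrow> inj_on (\<lambda>j. (u j, i j)) {..<k} \<Longrightarrow>
            dist (g' u) (f (\<lambda>j\<in>{..<k}. \<phi> (n (u j, i j)) (u j))) < 1 / Suc r"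
        have "inj_on (\<lambda>i. n (y i, i)) {..<m}"
          using r(1) by (intro inj_onI) (auto dest!: inj_onD[OF n(1)])
        moreover have "n (y i, i) \<noteq> 0" if "i < m" for i
        proof -
          have "(y i, i) \<in> y ` {..<m} \<times> {..<Suc r}" using that r by auto
          then show ?thesis using n(2) by (metis imageI)
        qed
        ultimately obtain z where z: "tilde k f z \<in> M" "\<And>i. i < m \<Longrightarrow> z i = \<phi> (n (y i, i)) (y i)"
          using spec[OF spec[OF spec[OF sample, of m], of "\<lambda>i. n (y i, i)"], of y] by blast
        show ?thesis
        proof (intro exI[of _ z] conjI z ballI impI)
          fix I assume I: "I \<in> distinct_tuples k" "I ` {..<k} \<subseteq> {..<m}"
          let ?x = "\<lambda>j\<in>{..<k}. y (I j)"
          have I_inj: "inj_on I {..<k}" and I_PiE: "I \<in> {..<k} \<rightarrow>\<^sub>E {..<m}"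
            using I by (auto simp: distinct_tuples_def PiE_iff)
          then have "?x \<in> ?T" by blast
          then have 1: "dist (g ?x) (g' ?x) < 1 / Suc r" by (rule g'(2))
          have "dist (g' ?x) (f (\<lambda>j\<in>{..<k}. \<phi> (n (?x j, I j)) (?x j))) < 1 / Suc r"
          proof (rule close)
            show "?x \<in> {..<k} \<rightarrow>\<^sub>E y ` {..<m}" using I(2) by auto
            show "I \<in> {..<k} \<rightarrow> {..<Suc r}" using I(2) r(1) by (fastforce simp: image_subset_iff)
            show "inj_on (\<lambda>j. (?x j, I j)) {..<k}" using I_inj by (auto simp: inj_on_def)
          qed
          moreover have "(\<lambda>j\<in>{..<k}. \<phi> (n (?x j, I j)) (?x j)) = (\<lambda>j\<in>{..<k}. z (I j))"
            using I(2) by (intro restrict_ext) (auto simp: z(2) image_subset_iff)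
          ultimately have "dist (g' ?x) (f (\<lambda>j\<in>{..<k}. z (I j))) < 1 / Suc r" by simp
          then have "dist (g ?x) (f (\<lambda>j\<in>{..<k}. z (I j))) < 2 / Suc r"
            using 1 dist_triangle[of "g ?x" "f (\<lambda>j\<in>{..<k}. z (I j))" "g' ?x"] by simp
          then show "dist (g ?x) (f (\<lambda>j\<in>{..<k}. z (I j))) < 1 / Suc r0" using r(2) by simp
        qed
      qed
    qed
  qed
qed

section \<open>Sampling maps for the constraint and for almost symmetry\<close>

lemma AE_seq_space_restrict:
  assumes X: "prob_space X" and P: "AE x in tuple_space k X. P x"
  shows "AE y in seq_space X. P (\<lambda>j\<in>{..<k}. y j)"
proof -
  have "distr (seq_space X) (tuple_space k X) (\<lambda>y. \<lambda>j\<in>{..<k}. y j) = tuple_space k X"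
    using distr_PiM_reindex[of UNIV "\<lambda>_. X" id "{..<k}"] X by simp
  with P have "AE x in distr (seq_space X) (tuple_space k X) (\<lambda>y. \<lambda>j\<in>{..<k}. y j). P x"
    by (simp only:)
  moreover have "(\<lambda>y. \<lambda>j\<in>{..<k}. y j) \<in> seq_space X \<rightarrow>\<^sub>M tuple_space k X"
    by (intro measurable_restrict measurable_component_singleton) auto
  ultimately show ?thesis by (rule AE_distrD[rotated])
qed

theorem theorem1:
  fixes X :: "'a measure" and k :: nat
    and f :: "(nat \<Rightarrow> 'a) \<Rightarrow> 'b::metric_space"
    and M :: "((nat \<Rightarrow> nat) \<Rightarrow> 'b) set"
  assumes "compact (UNIV :: 'b set)"
    and "prob_space X" and "standard_measure_space X" and "atomless X"
    and "k > 0"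
    and "tuple_measurable k X f"
    and "closedin (product_topology (\<lambda>_. euclidean) (distinct_tuples k)) M"
    and "AE y in seq_space X. tilde k f y \<in> M"
  shows "(\<exists>g. tuple_measurable k X g \<and> (AE x in tuple_space k X. g x = f x) \<and>
            (\<forall>y. (\<forall>i. y i \<in> space X) \<longrightarrow> inj y \<longrightarrow> tilde k g y \<in> M)) \<and>
         (almost_symmetric_fun k X f \<longrightarrow>
           (\<exists>g. tuple_measurable k X g \<and> symmetric_fun k X g \<and>
              (AE x in tuple_space k X. g x = f x) \<and>
              (\<forall>y. (\<forall>i. y i \<in> space X) \<longrightarrow> tilde k g y \<in> M)))"
proof (intro conjI impI)
  have ext: "x \<in> extensional {..<k}" if "x \<in> space (tuple_space k X)" for x
    using that by (auto simp: space_PiM PiE_def)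
  have good_imp_AE: "AE x in tuple_space k X. g x = f x"
    if "AE x in tuple_space k X. resampling_limit_point k \<phi> f x"
      "\<And>x. x \<in> extensional {..<k} \<Longrightarrow> resampling_limit_point k \<phi> f x \<Longrightarrow> g x = f x" for g \<phi>
    using that(1) AE_space by eventually_elim (intro that(2) ext)
  show "\<exists>g. tuple_measurable k X g \<and> (AE x in tuple_space k X. g x = f x) \<and>
            (\<forall>y. (\<forall>i. y i \<in> space X) \<longrightarrow> inj y \<longrightarrow> tilde k g y \<in> M)"
  proof -
    from exists_sampling_maps[OF assms(1-3) assms(6) assms(8)]
    obtain \<phi> where \<phi>: "\<forall>x. \<phi> 0 x = x"
      and sample: "\<forall>m (n :: nat \<Rightarrow> nat) y. inj_on n {..<m} \<longrightarrow> (\<forall>i<m. n i \<noteq> 0) \<longrightarrow>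
        (\<exists>z. tilde k f z \<in> M \<and> (\<forall>i<m. z i = \<phi> (n i) (y i)))"
      and good: "AE x in tuple_space k X. resampling_limit_point k \<phi> f x"
      by (elim exE conjE) (rule that)
    obtain g where g: "\<And>x. x \<in> extensional {..<k} \<Longrightarrow> resampling_limit_point k \<phi> f x \<Longrightarrow> g x = f x"
      "\<And>y. inj y \<Longrightarrow> tilde k g y \<in> M"
      by (rule everywhere_modification[OF assms(1) \<phi>[rule_format] assms(7) sample], rule that)
    have "AE x in tuple_space k X. g x = f x"
      using good g(1) by (rule good_imp_AE)
    then show ?thesis
      using tuple_measurable_AE_cong[OF assms(6)] g(2) by blast
  qed
  assume "almost_symmetric_fun k X f"
  then have "AE y in seq_space X. f (\<lambda>j\<in>{..<k}. y j) = f (\<lambda>j\<in>{..<k}. y (\<pi> j))" if "\<pi> permutes {..<k}" for \<pi>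
  proof -
    have "AE y in seq_space X. f (\<lambda>j\<in>{..<k}. y j) = f (\<lambda>j\<in>{..<k}. (\<lambda>j\<in>{..<k}. y j) (\<pi> j))"
      using \<open>almost_symmetric_fun k X f\<close> that unfolding almost_symmetric_fun_def
      by (intro AE_seq_space_restrict[OF assms(2)]) blast
    moreover have "(\<lambda>j\<in>{..<k}. (\<lambda>j\<in>{..<k}. y j) (\<pi> j)) = (\<lambda>j\<in>{..<k}. y (\<pi> j))" for y :: "nat \<Rightarrow> 'a"
      using permutes_in_image[OF that] by (intro restrict_ext) auto
    ultimately show ?thesis by simp
  qed
  moreover have "countable {\<pi>. \<pi> permutes {..<k}}"
    by (intro countable_finite finite_permutations) simp
  ultimately have "AE y in seq_space X. \<forall>\<pi>\<in>{\<pi>. \<pi> permutes {..<k}}.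
      f (\<lambda>j\<in>{..<k}. y j) = f (\<lambda>j\<in>{..<k}. y (\<pi> j))"
    by (subst AE_ball_countable) auto
  \<comment> \<open>Almost symmetry joins the constraint as a property of almost all sequences, so
    the sampling maps turn it into exact symmetry of \<open>f\<close> on the drawn points.\<close>
  with assms(8) have AE_sym: "AE y in seq_space X. tilde k f y \<in> M \<and> (\<forall>\<pi>. \<pi> permutes {..<k} \<longrightarrow>
        f (\<lambda>j\<in>{..<k}. y j) = f (\<lambda>j\<in>{..<k}. y (\<pi> j)))"
    by eventually_elim simp
  from exists_sampling_maps[OF assms(1-3) assms(6) AE_sym]
  obtain \<phi> where \<phi>: "\<forall>x. \<phi> 0 x = x"
    and sample: "\<forall>m (n :: nat \<Rightarrow> nat) y. inj_on n {..<m} \<longrightarrow> (\<forall>i<m. n i \<noteq> 0) \<longrightarrow>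
      (\<exists>z. (tilde k f z \<in> M \<and> (\<forall>\<pi>. \<pi> permutes {..<k} \<longrightarrow>
        f (\<lambda>j\<in>{..<k}. z j) = f (\<lambda>j\<in>{..<k}. z (\<pi> j)))) \<and> (\<forall>i<m. z i = \<phi> (n i) (y i)))"
    and good: "AE x in tuple_space k X. resampling_limit_point k \<phi> f x"
    by (elim exE conjE) (rule that)
  obtain g where g: "\<And>x. x \<in> extensional {..<k} \<Longrightarrow> resampling_limit_point k \<phi> f x \<Longrightarrow> g x = f x"
    "\<And>x \<pi>. x \<in> extensional {..<k} \<Longrightarrow> \<pi> permutes {..<k} \<Longrightarrow> g x = g (\<lambda>j\<in>{..<k}. x (\<pi> j))"
    "\<And>y. tilde k g y \<in> M"
    by (rule symmetric_everywhere_modification[OF assms(1) \<phi>[rule_format] assms(7) sample], rule that)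
  have "AE x in tuple_space k X. g x = f x"
    using good g(1) by (rule good_imp_AE)
  moreover have "symmetric_fun k X g"
    unfolding symmetric_fun_def using g(2) ext by blast
  ultimately show "\<exists>g. tuple_measurable k X g \<and> symmetric_fun k X g \<and>
              (AE x in tuple_space k X. g x = f x) \<and>
              (\<forall>y. (\<forall>i. y i \<in> space X) \<longrightarrow> tilde k g y \<in> M)"
    using tuple_measurable_AE_cong[OF assms(6)] g(3) by blast
qed

end
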